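(* Let $\epsilon>0$ and let $k$ be a positive integer. There exist $N=N(\epsilon,k)$ and $\delta=\delta(\epsilon,k)>0$ such that for every odd $n>N$ and every $(\epsilon,k)$-consistent orientation $H$ with $n$ vertices, $R(H)\ge (1+\delta)\,n!/2^{e(H)}$.
   Context: An orientation is a digraph obtained by orienting each edge of a finite simple undirected graph (its underlying graph $\hat H$); $(u,v)$ denotes an edge directed from $u$ to $v$. For a vertex $v$, $d^+(v)$ is its out-degree and $d^-(v)$ its in-degree; the maximum degree $\Delta(H)$ is the maximum degree of $\hat H$; $e(H)$ is the number of edges. Define $plus(H)=\sum_{v\in V(H)} d^+(v)d^-(v)$ and $minus(H)=\sum_{v\in V(H)}\left(\binom{d^+(v)}{2}+\binom{d^-(v)}{2}\right)$. For $\epsilon>0$ and a positive integer $k$, $H$ is an $(\epsilon,k)$-consistent orientation if $H$ has $n$ vertices, $\Delta(H)\le k$ and $plus(H)-minus(H)\ge \epsilon n$. A tournament is an orientation of a complete graph; a tournament on $n$ vertices ($n$ odd) is regular if every vertex has in-degree and out-degree $(n-1)/2$. For an orientation $H$ and a tournament $G$ on the same number of vertices, $G(H)$ denotes the number of labeled copies of $H$ in $G$, i.e. the number of bijections $\phi:V(H)\to V(G)$ such that $(\phi(u),\phi(v))$ is an edge of $G$ for every edge $(u,v)$ of $H$. For $H$ with an odd number $n$ of vertices, $R(H)$ is the maximum of $G(H)$ over all regular tournaments $G$ on $n$ vertices. *)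

theory Defs
  imports Complex_Main "HOL-Library.FuncSet" "Graph_Theory.Graph_Theory"
begin

text \<open>
  Following the library, a finite simple undirected graph is a \<^const>\<open>pair_graph\<close>: a finite,
  loopless, symmetric digraph, in which the edge joining \<open>u\<close> and \<open>v\<close> is the pair of arcs
  \<open>(u, v)\<close> and \<open>(v, u)\<close>. An oriented graph keeps exactly one arc of each such pair.
\<close>

definition orients :: "'a pair_pre_digraph \<Rightarrow> 'a pair_pre_digraph \<Rightarrow> bool" where
  "orients H U \<longleftrightarrow>
     pair_graph U \<and> pverts H = pverts U \<and> parcs H \<subseteq> parcs U \<and>
     (\<forall>u v. (u, v) \<in> parcs U \<longrightarrow> ((u, v) \<in> parcs H \<longleftrightarrow> (v, u) \<notin> parcs H))"

definition orientation :: "'a pair_pre_digraph \<Rightarrow> bool" where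
  "orientation H \<longleftrightarrow> (\<exists>U. orients H U)"

definition underlying_graph :: "'a pair_pre_digraph \<Rightarrow> 'a pair_pre_digraph" where
  "underlying_graph H = mk_symmetric (with_proj H)"

lemma orients_underlying_graph:
  assumes "orients H U"
  shows "U = underlying_graph H"
proof -
  interpret U: pair_graph U using assms by (simp add: orients_def)
  have sym: "(v, u) \<in> parcs U" if "(u, v) \<in> parcs U" for u v
    using U.sym_arcs that by (auto simp: symmetric_def dest: symD)
  have "parcs U = parcs (mk_symmetric (with_proj H))"
    using assms sym unfolding orients_def parcs_mk_symmetric by fastforce
  moreover have "pverts U = pverts (mk_symmetric (with_proj H))"
    using assms by (simp add: orients_def)
  ultimately show ?thesis by (simp add: underlying_graph_def)
qed

text \<open>
  In the symmetric representation the degree of a vertex is its out-degree. Inserting \<open>0\<close> only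
  serves to give the empty graph maximum degree \<open>0\<close>.
\<close>

definition max_degree :: "'a pair_pre_digraph \<Rightarrow> nat" where
  "max_degree H =
     Max (insert 0 (out_degree (with_proj (underlying_graph H)) ` pverts H))"

definition plus_sum :: "'a pair_pre_digraph \<Rightarrow> nat" where
  "plus_sum H =
     (\<Sum>v\<in>pverts H. out_degree (with_proj H) v * in_degree (with_proj H) v)"

definition minus_sum :: "'a pair_pre_digraph \<Rightarrow> nat" where
  "minus_sum H =
     (\<Sum>v\<in>pverts H. (out_degree (with_proj H) v choose 2) + (in_degree (with_proj H) v choose 2))"

definition consistent_orientation :: "real \<Rightarrow> nat \<Rightarrow> 'a pair_pre_digraph \<Rightarrow> bool" where
  "consistent_orientation \<epsilon> k H \<longleftrightarrow>
     orientation H \<and> max_degree H \<le> k \<and>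
     real (plus_sum H) - real (minus_sum H) \<ge> \<epsilon> * real (card (pverts H))"

definition tournament :: "'a pair_pre_digraph \<Rightarrow> bool" where
  "tournament G \<longleftrightarrow> (\<exists>U. orients G U \<and> complete_digraph (card (pverts U)) (with_proj U))"

definition regular_tournament :: "'a pair_pre_digraph \<Rightarrow> bool" where
  "regular_tournament G \<longleftrightarrow>
     tournament G \<and> odd (card (pverts G)) \<and>
     (\<forall>v\<in>pverts G. in_degree (with_proj G) v = (card (pverts G) - 1) div 2 \<and>
                   out_degree (with_proj G) v = (card (pverts G) - 1) div 2)"

text \<open>
  Bijections are taken in the extensional function space, so that each bijection between the
  vertex sets is counted exactly once.
\<close>

definition labeled_copies :: "'b pair_pre_digraph \<Rightarrow> 'a pair_pre_digraph \<Rightarrow> nat" where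
  "labeled_copies G H =
     card {\<phi> \<in> pverts H \<rightarrow>\<^sub>E pverts G.
             bij_betw \<phi> (pverts H) (pverts G) \<and>
             (\<forall>u v. (u, v) \<in> parcs H \<longrightarrow> (\<phi> u, \<phi> v) \<in> parcs G)}"

text \<open>
  The tournaments range over all vertex sets of the right size within the vertex type of \<open>H\<close>.
  One such set is the vertex set of \<open>H\<close> itself, so every isomorphism class of regular
  tournaments on that many vertices is represented.
\<close>

definition max_regular_copies :: "'a pair_pre_digraph \<Rightarrow> nat" where
  "max_regular_copies H =
     Max {labeled_copies G H |G :: 'a pair_pre_digraph.
            regular_tournament G \<and> card (pverts G) = card (pverts H)}"

lemma finite_regular_copies:
  fixes H :: "'a pair_pre_digraph"
  assumes "finite (pverts H)"
  shows "finite {labeled_copies G H |G :: 'a pair_pre_digraph.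
            regular_tournament G \<and> card (pverts G) = card (pverts H)}"
proof -
  let ?n = "card (pverts H)"
  have "labeled_copies G H \<le> ?n ^ ?n"
    if G: "regular_tournament G" and n: "card (pverts G) = ?n" for G :: "'a pair_pre_digraph"
  proof -
    from G have "finite (pverts G)"
      unfolding regular_tournament_def by (metis card.infinite even_zero)
    with assms have "labeled_copies G H \<le> card (pverts H \<rightarrow>\<^sub>E pverts G)"
      unfolding labeled_copies_def by (intro card_mono finite_PiE) auto
    also have "\<dots> = ?n ^ ?n" using assms n by (simp add: card_PiE)
    finally show ?thesis .
  qed
  then show ?thesis by (intro finite_subset[OF _ finite_atMost[of "?n ^ ?n"]]) auto
qed

end

theory Submission
  imports Defs "HOL-Combinatorics.Permutations"
begin

text \<open>
  Split all vertices but one into clusters of even size about \<open>q\<close>, where \<open>q\<close> is a large constant.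
  Each pair of clusters, and each single cluster together with the leftover vertex, is a block. Orient
  the blocks independently, each one uniformly among its balanced orientations; the union is a
  regular tournament. Place \<open>H\<close> into it by a random bijection \<open>p\<close>. Given \<open>p\<close>, the probability that
  \<open>p\<close> preserves all arcs, multiplied by \<open>2 ^ e(H)\<close>, factorizes over the blocks. For all \<open>p\<close> outside a
  set of measure \<open>O(1/n)\<close>, a block between two clusters receives at most two arcs, and an internal
  block at most one. Its factor is then \<open>1 + s\<close>, where \<open>s\<close> is the correlation of the two arcs, and
  \<open>|s| \<le> 1/(q - 1)\<close> for adjacent arcs, \<open>|s| \<le> 1/(q - 1)\<^sup>2\<close> for disjoint ones. So the product is at
  least \<open>exp (\<Sum>(s - 2 s\<^sup>2)) \<ge> 1 + \<Sum>(s - 2 s\<^sup>2)\<close>, of which only the first moment is needed. In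
  every regular tournament the expectation of \<open>\<Sum>s\<close> is \<open>(plus(H) - minus(H))/(n - 2)\<close>, which is at least
  \<open>\<epsilon>\<close>, while that of \<open>\<Sum>s\<^sup>2\<close> is \<open>O(k\<^sup>2/q)\<close>.
\<close>

section \<open>Averages over permutations\<close>

text \<open>\<open>H\<close> may have linearly many arcs, so the product over them cannot be
  expanded directly. Clusters of constant size keep every block bounded: the expected number of
  pairs sharing a block is bounded, and each further arc in the same block costs another factor
  \<open>O(1/n)\<close>. The size \<open>q\<close> also controls the correlations, so it is fixed
  first, large against \<open>k\<^sup>2/\<epsilon>\<close>, and \<open>N\<close> is chosen
  afterwards. No correlation is ever evaluated. After exchanging the averages over \<open>p\<close>
  and over orientations, regularity alone determines the linear term; bounds on \<open>|s|\<close>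
  serve only the quadratic term. There the bound for the number of disjoint pairs is worse by a
  factor \<open>B\<close> than that for adjacent pairs, which is why disjoint arcs need the squared
  correlation bound. Exceptional \<open>p\<close> are not discarded, since this would spoil the
  exact linear term. Instead a correction is subtracted that vanishes on good \<open>p\<close> and
  outweighs everything else on bad ones. It is a sum of indicators depending on few images, so its
  expectation, even multiplied by the number of pairs, remains \<open>O(1/n)\<close>.\<close>

definition depends_on :: "'a set \<Rightarrow> (('a \<Rightarrow> 'a) \<Rightarrow> 'b) \<Rightarrow> bool" where
  "depends_on P g \<longleftrightarrow> (\<forall>p q. (\<forall>v\<in>P. p v = q v) \<longrightarrow> g p = g q)"

lemma depends_on_transpose:
  assumes g: "depends_on P g" and "x \<notin> P" "y \<notin> P"
  shows "g (p \<circ> transpose x y) = g p"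
proof -
  have "\<forall>v\<in>P. (p \<circ> transpose x y) v = p v" using assms(2,3) by (auto simp: transpose_def)
  then show ?thesis using g[unfolded depends_on_def, rule_format, of "p \<circ> transpose x y" p] by simp
qed

lemma card_eq_sum_of_bool: "finite A \<Longrightarrow> real (card {y \<in> A. Q y}) = (\<Sum>y\<in>A. of_bool (Q y))"
  by (simp add: Int_def)

lemma sum_permutes_transpose:
  assumes "x \<in> V" "y \<in> V"
  shows "(\<Sum>p | p permutes V. f (p \<circ> transpose x y)) = (\<Sum>p | p permutes V. f p)"
  using sum_permutations_compose_right[OF permutes_swap_id[OF assms], of f] by simp

text \<open>Given the images of \<open>P\<close>, the image of \<open>x\<close> is uniform on the
  remaining vertices; the weight \<open>g\<close> takes the place of the conditioning. Composing
  \<open>p\<close> with a transposition of \<open>x\<close> and some \<open>y\<close> outside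
  \<open>P\<close> changes neither \<open>g\<close> nor \<open>S\<close>, so all such
  \<open>y\<close> give the same sum, and together they count preimages of points of
  \<open>S p\<close>.\<close>

lemma sum_permutes_hit_le:
  fixes g :: "('a \<Rightarrow> 'a) \<Rightarrow> real"
  assumes V: "finite V" and P: "P \<subseteq> V" and x: "x \<in> V - P"
    and g: "depends_on P g" and S: "depends_on P S"
    and nonneg: "\<And>p. p permutes V \<Longrightarrow> 0 \<le> g p"
    and B: "\<And>p. p permutes V \<Longrightarrow> card {w \<in> V. w \<in> S p} \<le> B"
  shows "real (card V - card P) * (\<Sum>p | p permutes V. g p * of_bool (p x \<in> S p))
    \<le> real B * (\<Sum>p | p permutes V. g p)"
proof -
  have fP: "finite P" using P V finite_subset by blast
  have "real (card V - card P) * (\<Sum>p | p permutes V. g p * of_bool (p x \<in> S p))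
      = (\<Sum>y\<in>V - P. \<Sum>p | p permutes V. g p * of_bool (p x \<in> S p))"
    using P fP by (simp add: card_Diff_subset)
  also have "\<dots> = (\<Sum>y\<in>V - P. \<Sum>p | p permutes V. g p * of_bool (p y \<in> S p))"
  proof (rule sum.cong[OF refl])
    fix y assume y: "y \<in> V - P"
    have "(\<Sum>p | p permutes V. g p * of_bool (p x \<in> S p))
        = (\<Sum>p | p permutes V. g (p \<circ> transpose x y) * of_bool ((p \<circ> transpose x y) x \<in> S (p \<circ> transpose x y)))"
      using x y by (intro sum_permutes_transpose[symmetric]) auto
    also have "\<dots> = (\<Sum>p | p permutes V. g p * of_bool (p y \<in> S p))"
      using x y depends_on_transpose[OF g] depends_on_transpose[OF S] by simp
    finally show "(\<Sum>p | p permutes V. g p * of_bool (p x \<in> S p))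
        = (\<Sum>p | p permutes V. g p * of_bool (p y \<in> S p))" .
  qed
  also have "\<dots> = (\<Sum>p | p permutes V. g p * real (card {y \<in> V - P. p y \<in> S p}))"
    using V by (subst sum.swap) (simp only: card_eq_sum_of_bool finite_Diff sum_distrib_left)
  also have "\<dots> \<le> (\<Sum>p | p permutes V. g p * real B)"
  proof (rule sum_mono)
    fix p assume "p \<in> {p. p permutes V}"
    then have p: "p permutes V" by simp
    have "card {y \<in> V - P. p y \<in> S p} \<le> card {w \<in> V. w \<in> S p}"
    proof (rule card_inj_on_le[of p])
      show "inj_on p {y \<in> V - P. p y \<in> S p}" using permutes_inj[OF p] inj_on_subset by blast
      show "p ` {y \<in> V - P. p y \<in> S p} \<subseteq> {w \<in> V. w \<in> S p}" using permutes_in_image[OF p] by auto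
    qed (use V in auto)
    then have "card {y \<in> V - P. p y \<in> S p} \<le> B" using B[OF p] by linarith
    then show "g p * real (card {y \<in> V - P. p y \<in> S p}) \<le> g p * real B"
      by (intro mult_left_mono) (use nonneg[OF p] in auto)
  qed
  finally show ?thesis by (simp add: sum_distrib_left mult.commute)
qed

text \<open>The sign matrix of a regular tournament. Outside \<open>V\<close> only antisymmetry is
  demanded, which also makes the diagonal zero.\<close>

definition regular_sign :: "'a set \<Rightarrow> ('a \<times> 'a \<Rightarrow> real) \<Rightarrow> bool" where
  "regular_sign V x \<longleftrightarrow>
     (\<forall>u\<in>V. \<forall>v\<in>V. u \<noteq> v \<longrightarrow> x (u, v) \<in> {1, -1}) \<and> (\<forall>u v. x (v, u) = - x (u, v)) \<and>
     (\<forall>u\<in>V. (\<Sum>v\<in>V. x (u, v)) = 0)"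

lemma regular_signD:
  assumes "regular_sign V x"
  shows "u \<in> V \<Longrightarrow> v \<in> V \<Longrightarrow> u \<noteq> v \<Longrightarrow> x (u, v) = 1 \<or> x (u, v) = -1"
    and "x (v, u) = - x (u, v)"
    and "x (u, u) = 0"
    and "u \<in> V \<Longrightarrow> (\<Sum>v\<in>V. x (u, v)) = 0"
proof -
  have "x (u, u) = - x (u, u)" using assms unfolding regular_sign_def by blast
  then show "x (u, u) = 0" by simp
qed (use assms in \<open>unfold regular_sign_def, blast+\<close>)

text \<open>Regularity makes the sum over all \<open>w\<close> vanish; the term \<open>w = v\<close> is \<open>n!\<close>, and the \<open>n - 2\<close> terms
  with \<open>w \<notin> {u, v}\<close> are equal by symmetry.\<close>

lemma sum_permutes_out_cherry:
  assumes V: "finite V" and x: "regular_sign V x"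
    and uvw: "u \<in> V" "v \<in> V" "w \<in> V" "u \<noteq> v" "w \<noteq> u" "w \<noteq> v"
  shows "(real (card V) - 2) * (\<Sum>p | p permutes V. x (p u, p v) * x (p u, p w)) = - fact (card V)"
proof -
  let ?\<Phi> = "{p. p permutes V}"
  define T where "T y = (\<Sum>p | p permutes V. x (p u, p v) * x (p u, p y))" for y
  have TT: "T y = T w" if "y \<in> V - {u, v}" for y
  proof -
    have "T y = (\<Sum>p | p permutes V. x ((p \<circ> transpose y w) u, (p \<circ> transpose y w) v) * x ((p \<circ> transpose y w) u, (p \<circ> transpose y w) y))"
      unfolding T_def using that uvw by (intro sum_permutes_transpose[symmetric]) auto
    also have "\<dots> = T w" unfolding T_def using that uvw by (auto simp: transpose_def)
    finally show ?thesis .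
  qed
  have "(\<Sum>y\<in>V. T y) = (\<Sum>p | p permutes V. x (p u, p v) * (\<Sum>y\<in>V. x (p u, p y)))"
    unfolding T_def by (subst sum.swap) (simp add: sum_distrib_left)
  also have "\<dots> = 0"
  proof (rule sum.neutral, rule ballI)
    fix p assume "p \<in> ?\<Phi>"
    then have p: "p permutes V" by simp
    have "(\<Sum>y\<in>V. x (p u, p y)) = (\<Sum>y\<in>V. x (p u, y))"
      using sum.permute[OF p, of "\<lambda>y. x (p u, y)"] by simp
    also have "\<dots> = 0" using regular_signD(4)[OF x] permutes_in_image[OF p] uvw by simp
    finally show "x (p u, p v) * (\<Sum>y\<in>V. x (p u, p y)) = 0" by simp
  qed
  finally have sum0: "(\<Sum>y\<in>V. T y) = 0" .
  have "(\<Sum>y\<in>V. T y) = (\<Sum>y\<in>V - {u, v}. T y) + T u + T v"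
    using V uvw by (subst sum.subset_diff[of "{u, v}"]) auto
  moreover have "(\<Sum>y\<in>V - {u, v}. T y) = (real (card V) - 2) * T w"
  proof -
    have "card V \<ge> card {u,v}" using V uvw by (intro card_mono) auto
    moreover have "(\<Sum>y\<in>V - {u, v}. T y) = (\<Sum>y\<in>V - {u, v}. T w)"
      by (rule sum.cong[OF refl]) (rule TT)
    ultimately show ?thesis using uvw V by (simp add: card_Diff_subset of_nat_diff)
  qed
  moreover have "T u = 0" unfolding T_def by (simp add: regular_signD(3)[OF x])
  moreover have "T v = fact (card V)"
  proof -
    have "x (p u, p v) * x (p u, p v) = 1" if p: "p permutes V" for p
    proof -
      have "p u \<noteq> p v" using permutes_inj[OF p] uvw by (simp add: inj_eq)
      then have "x (p u, p v) = 1 \<or> x (p u, p v) = -1"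
        using permutes_in_image[OF p] uvw by (intro regular_signD(1)[OF x]) auto
      then show ?thesis by auto
    qed
    then show ?thesis unfolding T_def using V card_permutations[of V] by simp
  qed
  ultimately show ?thesis using sum0 unfolding T_def by linarith
qed

text \<open>Composing \<open>p\<close> with the transposition of \<open>u\<close> and
  \<open>v\<close> reverses the first arc and leaves the second alone, so the sum equals its own
  negative.\<close>

lemma sum_permutes_disjoint_arcs:
  fixes x :: "'a \<times> 'a \<Rightarrow> real"
  assumes x: "regular_sign V x"
    and uv: "u \<in> V" "v \<in> V" "a \<notin> {u, v}" "b \<notin> {u, v}"
  shows "(\<Sum>p | p permutes V. x (p u, p v) * x (p a, p b)) = 0"
proof -
  let ?t = "transpose u v"
  have "(\<Sum>p | p permutes V. x (p u, p v) * x (p a, p b))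
     = (\<Sum>p | p permutes V. x ((p \<circ> ?t) u, (p \<circ> ?t) v) * x ((p \<circ> ?t) a, (p \<circ> ?t) b))"
    using uv by (intro sum_permutes_transpose[symmetric]) auto
  also have "\<dots> = (\<Sum>p | p permutes V. x (p v, p u) * x (p a, p b))"
    using uv by (simp add: transpose_def)
  also have "\<dots> = - (\<Sum>p | p permutes V. x (p u, p v) * x (p a, p b))"
    using x unfolding regular_sign_def by (metis (no_types, lifting) minus_mult_left sum_negf sum.cong)
  finally show ?thesis by simp
qed

text \<open>Reversing an arc changes the sign, so every way of sharing a vertex reduces to two arcs
  leaving a common vertex. A directed path gains and a shared head or tail loses; this is the origin
  of \<open>plus(H) - minus(H)\<close>.\<close>

lemma sum_permutes_two_arcs:
  assumes V: "finite V" "card V > 2" and x: "regular_sign V x"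
    and abcd: "a \<in> V" "b \<in> V" "c \<in> V" "d \<in> V" "a \<noteq> b" "c \<noteq> d" "(a, b) \<noteq> (c, d)" "(a, b) \<noteq> (d, c)"
  shows "(\<Sum>p | p permutes V. x (p a, p b) * x (p c, p d)) =
    fact (card V) / (real (card V) - 2) *
      (of_bool (b = c) + of_bool (a = d) - of_bool (a = c) - of_bool (b = d))"
proof -
  have n: "real (card V) - 2 > 0" using V by simp
  have sw: "x (v, u) = - x (u, v)" for u v using x unfolding regular_sign_def by blast
  have cherry: "(\<Sum>p | p permutes V. x (p u, p v) * x (p u, p w)) = - fact (card V) / (real (card V) - 2)"
    if "u \<in> V" "v \<in> V" "w \<in> V" "u \<noteq> v" "w \<noteq> u" "w \<noteq> v" for u v w
    using sum_permutes_out_cherry[OF V(1) x that] n by (simp add: field_simps)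
  have neg: "(\<Sum>p | p permutes V. x (p v, p u) * f p) = - (\<Sum>p | p permutes V. x (p u, p v) * f p)" for f u v
    by (subst sw) (simp add: sum_negf)
  have neg': "(\<Sum>p | p permutes V. f p * x (p v, p u)) = - (\<Sum>p | p permutes V. f p * x (p u, p v))" for f u v
    by (subst sw) (simp add: sum_negf)
  consider "a = c" | "b = d" | "b = c" | "a = d" | "a \<notin> {c, d}" "b \<notin> {c,d}" by blast
  then show ?thesis
  proof cases
    case 1
    then show ?thesis using cherry[of a b d] abcd by auto
  next
    case 2
    have "(\<Sum>p | p permutes V. x (p a, p b) * x (p c, p d)) = (\<Sum>p | p permutes V. x (p b, p a) * x (p b, p c))"
      by (subst neg, subst neg') (use 2 in simp)
    then show ?thesis using cherry[of b a c] abcd 2 by auto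
  next
    case 3
    have "(\<Sum>p | p permutes V. x (p a, p b) * x (p c, p d)) = - (\<Sum>p | p permutes V. x (p b, p a) * x (p b, p d))"
      by (subst neg) (use 3 in simp)
    then show ?thesis using cherry[of b a d] abcd 3 by auto
  next
    case 4
    have "(\<Sum>p | p permutes V. x (p a, p b) * x (p c, p d)) = - (\<Sum>p | p permutes V. x (p a, p b) * x (p a, p c))"
      by (subst neg') (use 4 in simp)
    then show ?thesis using cherry[of a b c] abcd 4 by auto
  next
    case 5
    then show ?thesis using sum_permutes_disjoint_arcs[OF x, of a b c d] abcd by auto
  qed
qed

definition ends :: "'a \<times> 'a \<Rightarrow> 'a set" where
  "ends e = {fst e, snd e}"

lemma finite_ends [simp]: "finite (ends e)"
  by (simp add: ends_def)

lemma card_ends_le: "card (ends e) \<le> 2"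
  by (simp add: ends_def card_insert_if)

lemma depends_on_mono: "depends_on P g \<Longrightarrow> P \<subseteq> Q \<Longrightarrow> depends_on Q g"
  unfolding depends_on_def by blast

section \<open>Arcs falling into a common block\<close>

text \<open>\<open>K w\<close> is \<open>{i}\<close> for a vertex \<open>w\<close> of cluster \<open>i\<close> and \<open>{}\<close> for the leftover vertex, which thereby
  belongs to the internal block of every cluster. Blocks are named by the set of the clusters
  involved: two for a pair of clusters, at most one for an internal block.\<close>

locale clustering =
  fixes V :: "'a set" and K :: "'a \<Rightarrow> nat set" and B q :: nat
  assumes finite_V: "finite V"
    and K_cases: "w \<in> V \<Longrightarrow> K w = {} \<or> (\<exists>i. K w = {i})"
    and card_below: "finite \<beta> \<Longrightarrow> card \<beta> \<le> 2 \<Longrightarrow> card {w \<in> V. K w \<subseteq> \<beta>} \<le> B"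
    and cluster_size: "w \<in> V \<Longrightarrow> K w = {i} \<Longrightarrow> q \<le> card {w' \<in> V. K w' = {i}}"
begin

definition block :: "'a \<times> 'a \<Rightarrow> nat set" where
  "block z = K (fst z) \<union> K (snd z)"

abbreviation blk :: "('a \<Rightarrow> 'a) \<Rightarrow> 'a \<times> 'a \<Rightarrow> nat set" where
  "blk p e \<equiv> block (map_prod p p e)"

lemma block_bounds: "z \<in> V \<times> V \<Longrightarrow> finite (block z) \<and> card (block z) \<le> 2"
  using K_cases[of "fst z"] K_cases[of "snd z"] by (auto simp: block_def card_insert_if)

lemma blk_bounds: "p permutes V \<Longrightarrow> e \<in> V \<times> V \<Longrightarrow> finite (blk p e) \<and> card (blk p e) \<le> 2"
  by (intro block_bounds) (auto simp: permutes_in_image)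

lemma depends_on_blk: "ends e \<subseteq> P \<Longrightarrow> depends_on P (\<lambda>p. blk p e)"
  unfolding depends_on_def ends_def block_def by auto

end

locale clustered_orientation = clustering V K B q
  for V :: "'a set" and K B q +
  fixes E :: "('a \<times> 'a) set" and k :: nat
  assumes E_subset: "E \<subseteq> V \<times> V"
    and asym: "(u, v) \<in> E \<Longrightarrow> (v, u) \<notin> E"
    and degree_le: "v \<in> V \<Longrightarrow> card {e \<in> E. v \<in> ends e} \<le> k"
    and n_ge: "card V \<ge> 20"
begin

abbreviation n :: real where "n \<equiv> real (card V)"

lemma finite_E: "finite E"
  using E_subset finite_V finite_subset by blast

lemma ends_E: "e \<in> E \<Longrightarrow> ends e \<subseteq> V"
  using E_subset by (auto simp: ends_def)

text \<open>\<open>ends\<close> forgets the direction; asymmetry recovers it and also excludes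
  loops, so that inclusion of the ends already means equality.\<close>

lemma ends_subset_iff: "e \<in> E \<Longrightarrow> e' \<in> E \<Longrightarrow> ends e' \<subseteq> ends e \<longleftrightarrow> e' = e"
  using asym by (cases e; cases e') (auto simp: ends_def)

lemma card_E_touching_le:
  assumes "P \<subseteq> V"
  shows "card {e \<in> E. ends e \<inter> P \<noteq> {}} \<le> card P * k"
proof -
  have fP: "finite P" using assms finite_V finite_subset by blast
  have "{e \<in> E. ends e \<inter> P \<noteq> {}} = (\<Union>v\<in>P. {e \<in> E. v \<in> ends e})" by auto
  then have "card {e \<in> E. ends e \<inter> P \<noteq> {}} \<le> (\<Sum>v\<in>P. card {e \<in> E. v \<in> ends e})"
    using card_UN_le[OF fP] by simp
  also have "\<dots> \<le> card P * k"
    using sum_bounded_above[of P "\<lambda>v. card {e \<in> E. v \<in> ends e}" k] degree_le assms by (simp add: subset_iff)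
  finally show ?thesis .
qed

lemma card_E_le: "real (card E) \<le> n * k"
proof -
  have "{e \<in> E. ends e \<inter> V \<noteq> {}} = E" using ends_E by (auto simp: ends_def)
  then have "card E \<le> card V * k" using card_E_touching_le[of V] by simp
  then show ?thesis by (metis of_nat_le_iff of_nat_mult)
qed

section \<open>Hitting a prescribed block while the images of a few vertices are fixed\<close>

lemma sum_hit:
  assumes P: "P \<subseteq> V" "card P \<le> 9" and x: "x \<in> V - P"
    and g: "depends_on P g" "\<And>p. p permutes V \<Longrightarrow> 0 \<le> g p"
    and S: "depends_on P S" "\<And>p. p permutes V \<Longrightarrow> card {w \<in> V. w \<in> S p} \<le> B"
  shows "(\<Sum>p | p permutes V. g p * of_bool (p x \<in> S p)) \<le> 2 * B / n * (\<Sum>p | p permutes V. g p)"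
proof -
  let ?A = "\<Sum>p | p permutes V. g p * of_bool (p x \<in> S p)" and ?G = "\<Sum>p | p permutes V. g p"
  have A: "?A \<ge> 0" by (intro sum_nonneg) (auto intro: g)
  \<comment> \<open>With at most \<open>9\<close> vertices fixed among at least \<open>20\<close>,
    half of them stay free. The \<open>9\<close> is the eight vertices of the later applications
    plus one exposed in between.\<close>
  have "n / 2 \<le> real (card V - card P)" using P n_ge by linarith
  then have "n / 2 * ?A \<le> real (card V - card P) * ?A" using A by (intro mult_right_mono) auto
  also have "\<dots> \<le> B * ?G"
    using P x g S by (intro sum_permutes_hit_le finite_V) auto
  finally show ?thesis using n_ge by (simp add: field_simps)
qed

text \<open>One end outside \<open>P\<close> suffices: it has to land among the at most
  \<open>B\<close> vertices whose cluster takes part in the block.\<close>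

lemma sum_same_block_le:
  assumes P: "P \<subseteq> V" "card P \<le> 9" and e: "e \<in> E" "\<not> ends e \<subseteq> P"
    and g: "depends_on P g" "\<And>p. p permutes V \<Longrightarrow> 0 \<le> g p"
    and \<beta>: "depends_on P \<beta>" "\<And>p. p permutes V \<Longrightarrow> finite (\<beta> p) \<and> card (\<beta> p) \<le> 2"
  shows "(\<Sum>p | p permutes V. g p * of_bool (blk p e = \<beta> p)) \<le> 2 * B / n * (\<Sum>p | p permutes V. g p)"
proof -
  obtain x where x: "x \<in> ends e" "x \<notin> P" using e by blast
  have "(\<Sum>p | p permutes V. g p * of_bool (blk p e = \<beta> p))
    \<le> (\<Sum>p | p permutes V. g p * of_bool (p x \<in> {w. K w \<subseteq> \<beta> p}))"
    using x g by (intro sum_mono mult_left_mono) (auto simp: ends_def block_def)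
  also have "\<dots> \<le> 2 * B / n * (\<Sum>p | p permutes V. g p)"
  proof (rule sum_hit[OF P _ g])
    show "depends_on P (\<lambda>p. {w. K w \<subseteq> \<beta> p})" using \<beta>(1) unfolding depends_on_def by metis
    show "card {w \<in> V. w \<in> {w. K w \<subseteq> \<beta> p}} \<le> B" if "p permutes V" for p
      using card_below[of "\<beta> p"] \<beta>(2)[OF that] by simp
  qed (use x ends_E[OF e(1)] in auto)
  finally show ?thesis .
qed

text \<open>Both ends are free; they are exposed one after the other, and each contributes a factor
  \<open>2 * B / n\<close>.\<close>

lemma sum_same_block_disjoint_le:
  assumes P: "P \<subseteq> V" "card P \<le> 8" and e: "e \<in> E" "ends e \<inter> P = {}"
    and g: "depends_on P g" "\<And>p. p permutes V \<Longrightarrow> 0 \<le> g p"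
    and \<beta>: "depends_on P \<beta>" "\<And>p. p permutes V \<Longrightarrow> finite (\<beta> p) \<and> card (\<beta> p) \<le> 2"
  shows "(\<Sum>p | p permutes V. g p * of_bool (blk p e = \<beta> p)) \<le> (2 * B / n)\<^sup>2 * (\<Sum>p | p permutes V. g p)"
proof -
  define u v where "u = fst e" and "v = snd e"
  have "(u, v) \<in> E" using e(1) by (simp add: u_def v_def)
  then have uv: "u \<in> V" "v \<in> V" "u \<notin> P" "v \<notin> P" "u \<noteq> v"
    using e(2) E_subset asym[of u v] unfolding ends_def u_def v_def by auto
  define S where "S p = {w. K w \<subseteq> \<beta> p}" for p
  have S: "depends_on P S" using \<beta>(1) unfolding depends_on_def S_def by metis
  have SB: "card {w \<in> V. w \<in> S p} \<le> B" if "p permutes V" for p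
    using card_below[of "\<beta> p"] \<beta>(2)[OF that] by (simp add: S_def)
  have fP: "finite P" using P finite_V finite_subset by blast
  have "(\<Sum>p | p permutes V. g p * of_bool (blk p e = \<beta> p))
    \<le> (\<Sum>p | p permutes V. (g p * of_bool (p u \<in> S p)) * of_bool (p v \<in> S p))"
    using g by (intro sum_mono) (auto simp: u_def v_def S_def block_def)
  also have "\<dots> \<le> 2 * B / n * (\<Sum>p | p permutes V. g p * of_bool (p u \<in> S p))"
  proof (rule sum_hit[where P = "insert u P"])
    show "depends_on (insert u P) (\<lambda>p. g p * of_bool (p u \<in> S p))"
      using g(1) S unfolding depends_on_def by (metis insertCI)
    show "depends_on (insert u P) S" by (rule depends_on_mono[OF S]) auto
  qed (use P uv g SB fP in \<open>auto simp: card_insert_if\<close>)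
  also have "\<dots> \<le> 2 * B / n * (2 * B / n * (\<Sum>p | p permutes V. g p))"
    using P uv g S SB by (intro mult_left_mono sum_hit) auto
  finally show ?thesis by (simp add: power2_eq_square mult.assoc)
qed

text \<open>\<open>C / n\<close> bounds the expected number of arcs that hit a prescribed block, given the images of at
  most eight vertices and not counting arcs between those.\<close>

definition C :: real where "C = 16 * k * B + 4 * k * B\<^sup>2"

lemma C_nonneg: "C \<ge> 0"
  by (simp add: C_def)

text \<open>Arcs meeting \<open>P\<close> pay the factor \<open>2 * B / n\<close> only once, but
  there are at most \<open>8 * k\<close> of them; the up to \<open>n * k\<close> arcs away from
  \<open>P\<close> pay it twice. Both groups are of order \<open>1/n\<close> and yield the two
  summands of \<open>C\<close>.\<close>

lemma sum_new_arcs_le: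
  assumes P: "P \<subseteq> V" "card P \<le> 8"
    and g: "depends_on P g" "\<And>p. p permutes V \<Longrightarrow> 0 \<le> g p"
    and \<beta>: "depends_on P \<beta>" "\<And>p. p permutes V \<Longrightarrow> finite (\<beta> p) \<and> card (\<beta> p) \<le> 2"
  shows "(\<Sum>p | p permutes V. g p * real (card {e \<in> E. \<not> ends e \<subseteq> P \<and> blk p e = \<beta> p}))
    \<le> C / n * (\<Sum>p | p permutes V. g p)"
proof -
  let ?G = "\<Sum>p | p permutes V. g p"
  define T where "T = {e \<in> E. ends e \<inter> P \<noteq> {}}"
  define X where "X = {e \<in> E. \<not> ends e \<subseteq> P}"
  have G: "?G \<ge> 0" by (intro sum_nonneg) (auto intro: g)
  have fin: "finite X" "finite T" "X \<subseteq> E" "T \<subseteq> E" unfolding X_def T_def using finite_E by auto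
  have cT: "real (card T) \<le> 8 * k"
    using card_E_touching_le[OF P(1)] mult_le_mono1[OF P(2), of k] unfolding T_def by linarith
  have "(\<Sum>p | p permutes V. g p * real (card {e \<in> E. \<not> ends e \<subseteq> P \<and> blk p e = \<beta> p}))
      = (\<Sum>e\<in>X. \<Sum>p | p permutes V. g p * of_bool (blk p e = \<beta> p))"
  proof (subst sum.swap, rule sum.cong[OF refl])
    fix p
    have "{e \<in> E. \<not> ends e \<subseteq> P \<and> blk p e = \<beta> p} = {e \<in> X. blk p e = \<beta> p}" unfolding X_def by auto
    then show "g p * real (card {e \<in> E. \<not> ends e \<subseteq> P \<and> blk p e = \<beta> p}) = (\<Sum>e\<in>X. g p * of_bool (blk p e = \<beta> p))"
      using fin by (simp only: card_eq_sum_of_bool sum_distrib_left)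
  qed
  also have "\<dots> = (\<Sum>e\<in>X \<inter> T. \<Sum>p | p permutes V. g p * of_bool (blk p e = \<beta> p))
     + (\<Sum>e\<in>X - T. \<Sum>p | p permutes V. g p * of_bool (blk p e = \<beta> p))"
    using fin by (simp add: sum.Int_Diff)
  also have "\<dots> \<le> (\<Sum>e\<in>X \<inter> T. 2 * B / n * ?G) + (\<Sum>e\<in>X - T. (2 * B / n)\<^sup>2 * ?G)"
  proof (intro add_mono sum_mono)
    fix e assume "e \<in> X \<inter> T"
    then show "(\<Sum>p | p permutes V. g p * of_bool (blk p e = \<beta> p)) \<le> 2 * B / n * ?G"
      using P g \<beta> by (intro sum_same_block_le) (auto simp: X_def)
  next
    fix e assume "e \<in> X - T"
    then show "(\<Sum>p | p permutes V. g p * of_bool (blk p e = \<beta> p)) \<le> (2 * B / n)\<^sup>2 * ?G"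
      using P g \<beta> by (intro sum_same_block_disjoint_le) (auto simp: X_def T_def)
  qed
  also have "\<dots> = real (card (X \<inter> T)) * (2 * B / n * ?G) + real (card (X - T)) * ((2 * B / n)\<^sup>2 * ?G)"
    by simp
  also have "\<dots> \<le> (8 * k) * (2 * B / n * ?G) + (n * k) * ((2 * B / n)\<^sup>2 * ?G)"
  proof (intro add_mono mult_right_mono)
    show "real (card (X \<inter> T)) \<le> 8 * k"
      using cT card_mono[OF fin(2), of "X \<inter> T"] by simp
    show "real (card (X - T)) \<le> n * k"
      using card_E_le card_mono[OF finite_E, of "X - T"] fin(3) by force
  qed (use G in auto)
  also have "\<dots> = C / n * ?G"
    using n_ge by (simp add: C_def field_simps power2_eq_square)
  finally show ?thesis .
qed

definition same_pairs :: "('a \<Rightarrow> 'a) \<Rightarrow> (('a \<times> 'a) \<times> ('a \<times> 'a)) set" where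
  "same_pairs p = {(e, e') \<in> E \<times> E. e \<noteq> e' \<and> blk p e = blk p e'}"

lemma finite_same_pairs: "finite (same_pairs p)"
  by (rule finite_subset[of _ "E \<times> E"]) (auto simp: same_pairs_def finite_E)

text \<open>Fixing six images can force only boundedly many coincidences, namely pairs whose arcs
  both meet \<open>P\<close>. In any other pair one arc brings a vertex outside \<open>P\<close> and
  outside the other arc, and \<open>6 + 2 = 8\<close> fixed vertices are what
  \<open>sum_new_arcs_le\<close> admits.\<close>

lemma sum_same_pairs_le:
  assumes P: "P \<subseteq> V" "card P \<le> 6"
    and g: "depends_on P g" "\<And>p. p permutes V \<Longrightarrow> 0 \<le> g p"
  shows "(\<Sum>p | p permutes V. g p * real (card (same_pairs p)))
    \<le> (36 * k\<^sup>2 + 2 * k * C) * (\<Sum>p | p permutes V. g p)"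
proof -
  let ?G = "\<Sum>p | p permutes V. g p"
  define T where "T = {e \<in> E. ends e \<inter> P \<noteq> {}}"
  define N where "N p e = {e' \<in> E. \<not> ends e' \<subseteq> P \<union> ends e \<and> blk p e' = blk p e}" for p e
  have G: "?G \<ge> 0" by (intro sum_nonneg) (auto intro: g)
  have fT: "finite T" and fN: "finite (N p e)" for p e unfolding T_def N_def using finite_E by auto
  have cT: "card T \<le> 6 * k"
    using card_E_touching_le[OF P(1)] mult_le_mono1[OF P(2), of k] unfolding T_def by linarith
  have fP: "finite P" using P finite_V finite_subset by blast
  have W: "real (card (same_pairs p)) \<le> 36 * k\<^sup>2 + 2 * (\<Sum>e\<in>E. real (card (N p e)))" for p
  proof -
    have "same_pairs p \<subseteq> T \<times> T \<union> (Sigma E (N p) \<union> prod.swap ` Sigma E (N p))"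
    proof
      fix z assume "z \<in> same_pairs p"
      then obtain e e' where z: "z = (e, e')" "e \<in> E" "e' \<in> E" "e \<noteq> e'" "blk p e = blk p e'"
        unfolding same_pairs_def by auto
      show "z \<in> T \<times> T \<union> (Sigma E (N p) \<union> prod.swap ` Sigma E (N p))"
      proof (cases "ends e' \<subseteq> P \<union> ends e \<and> ends e \<subseteq> P \<union> ends e'")
        case True
        \<comment> \<open>Neither arc lies within the other, so each needs \<open>P\<close> to cover
          one of its ends.\<close>
        have "\<not> ends e \<subseteq> ends e'" "\<not> ends e' \<subseteq> ends e" using ends_subset_iff z by auto
        then have "ends e \<inter> P \<noteq> {}" "ends e' \<inter> P \<noteq> {}" using True by blast+
        then show ?thesis using z unfolding T_def by auto
      next
        case False
        then have "e' \<in> N p e \<or> e \<in> N p e'" using z unfolding N_def by auto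
        then show ?thesis using z by (auto simp: image_iff)
      qed
    qed
    then have "card (same_pairs p) \<le> card (T \<times> T \<union> (Sigma E (N p) \<union> prod.swap ` Sigma E (N p)))"
      using fT fN finite_E by (intro card_mono) auto
    also have "\<dots> \<le> card (T \<times> T) + (card (Sigma E (N p)) + card (prod.swap ` Sigma E (N p)))"
      by (meson add_left_mono card_Un_le order_trans)
    also have "\<dots> \<le> card T * card T + 2 * (\<Sum>e\<in>E. card (N p e))"
      using finite_E fN card_image_le[of "Sigma E (N p)" prod.swap] by (simp add: card_cartesian_product)
    also have "\<dots> \<le> (6 * k) * (6 * k) + 2 * (\<Sum>e\<in>E. card (N p e))"
      using cT by (intro add_right_mono mult_le_mono) auto
    finally have "real (card (same_pairs p)) \<le> real ((6 * k) * (6 * k) + 2 * (\<Sum>e\<in>E. card (N p e)))"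
      by (simp only: of_nat_le_iff)
    then show ?thesis by (simp add: power2_eq_square)
  qed
  have "(\<Sum>p | p permutes V. g p * real (card (same_pairs p)))
     \<le> (\<Sum>p | p permutes V. g p * (36 * k\<^sup>2 + 2 * (\<Sum>e\<in>E. real (card (N p e)))))"
    by (intro sum_mono mult_left_mono W) (auto intro: g)
  also have "\<dots> = 36 * k\<^sup>2 * ?G + 2 * (\<Sum>e\<in>E. \<Sum>p | p permutes V. g p * real (card (N p e)))"
    by (subst sum.swap) (simp add: distrib_left sum.distrib sum_distrib_left sum_distrib_right mult_ac)
  also have "\<dots> \<le> 36 * k\<^sup>2 * ?G + 2 * (\<Sum>e\<in>E. C / n * ?G)"
  proof (intro add_left_mono mult_left_mono sum_mono)
    fix e assume e: "e \<in> E"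
    have "card (P \<union> ends e) \<le> 8" using card_Un_le[of P "ends e"] card_ends_le[of e] P by linarith
    then show "(\<Sum>p | p permutes V. g p * real (card (N p e))) \<le> C / n * ?G"
      unfolding N_def using P e ends_E[OF e] E_subset g blk_bounds
      by (intro sum_new_arcs_le depends_on_blk depends_on_mono[OF g(1)]) auto
  qed simp
  also have "\<dots> = 36 * k\<^sup>2 * ?G + 2 * (real (card E) * (C / n * ?G))" by simp
  also have "\<dots> \<le> 36 * k\<^sup>2 * ?G + 2 * (n * k * (C / n * ?G))"
    using G C_nonneg by (intro add_left_mono mult_left_mono mult_right_mono card_E_le) auto
  also have "\<dots> = (36 * k\<^sup>2 + 2 * k * C) * ?G" using n_ge by (simp add: field_simps)
  finally show ?thesis .
qed


section \<open>Expected numbers of adjacent and of disjoint pairs in a common block\<close>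

definition adjacent_same_pairs :: "('a \<Rightarrow> 'a) \<Rightarrow> (('a \<times> 'a) \<times> ('a \<times> 'a)) set" where
  "adjacent_same_pairs p = {(e, e') \<in> same_pairs p. ends e \<inter> ends e' \<noteq> {}}"

definition disjoint_same_pairs :: "('a \<Rightarrow> 'a) \<Rightarrow> (('a \<times> 'a) \<times> ('a \<times> 'a)) set" where
  "disjoint_same_pairs p = {(e, e') \<in> same_pairs p. ends e \<inter> ends e' = {}}"

lemma sum_one_permutes: "(\<Sum>p | p permutes V. 1 :: real) = fact (card V)"
  using card_permutations[OF refl finite_V] by simp

lemma depends_on_const: "depends_on P (\<lambda>p. c)"
  by (simp add: depends_on_def)

text \<open>At most \<open>n * k * (2 * k)\<close> ordered pairs are adjacent, and each shares a
  block with probability at most \<open>2 * B / n\<close>; the result is linear in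
  \<open>B\<close>.\<close>

lemma sum_adjacent_same_pairs_le:
  "(\<Sum>p | p permutes V. real (card (adjacent_same_pairs p))) \<le> 4 * k\<^sup>2 * B * fact (card V)"
proof -
  define X where "X = Sigma E (\<lambda>e. {e' \<in> E. ends e' \<inter> ends e \<noteq> {} \<and> e' \<noteq> e})"
  have fX: "finite X" unfolding X_def using finite_E by auto
  have "card X \<le> card E * (2 * k)"
  proof -
    have "card {e' \<in> E. ends e' \<inter> ends e \<noteq> {} \<and> e' \<noteq> e} \<le> 2 * k" if "e \<in> E" for e
    proof -
      have "card {e' \<in> E. ends e' \<inter> ends e \<noteq> {} \<and> e' \<noteq> e} \<le> card {e' \<in> E. ends e' \<inter> ends e \<noteq> {}}"
        using finite_E by (intro card_mono) auto
      also have "\<dots> \<le> 2 * k"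
        using card_E_touching_le[OF ends_E[OF that]] mult_le_mono1[OF card_ends_le[of e], of k] by linarith
      finally show ?thesis .
    qed
    then have "(\<Sum>e\<in>E. card {e' \<in> E. ends e' \<inter> ends e \<noteq> {} \<and> e' \<noteq> e}) \<le> card E * (2 * k)"
      using sum_bounded_above[of E _ "2 * k"] by simp
    then show ?thesis unfolding X_def using finite_E by simp
  qed
  then have "real (card X) \<le> real (card E) * (2 * k)" by (metis of_nat_le_iff of_nat_mult)
  also have "\<dots> \<le> (n * k) * (2 * k)" by (intro mult_right_mono card_E_le) auto
  finally have cX: "real (card X) \<le> (n * k) * (2 * k)" .
  have "(\<Sum>p | p permutes V. real (card (adjacent_same_pairs p)))
     = (\<Sum>p | p permutes V. \<Sum>z\<in>X. of_bool (blk p (snd z) = blk p (fst z)))"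
  proof (rule sum.cong[OF refl])
    fix p
    have "adjacent_same_pairs p = {z \<in> X. blk p (snd z) = blk p (fst z)}"
      unfolding adjacent_same_pairs_def same_pairs_def X_def by auto
    then show "real (card (adjacent_same_pairs p)) = (\<Sum>z\<in>X. of_bool (blk p (snd z) = blk p (fst z)))"
      using fX by (simp only: card_eq_sum_of_bool)
  qed
  also have "\<dots> = (\<Sum>z\<in>X. \<Sum>p | p permutes V. 1 * of_bool (blk p (snd z) = blk p (fst z)))"
    by (subst sum.swap) simp
  also have "\<dots> \<le> (\<Sum>z\<in>X. 2 * B / n * (\<Sum>p | p permutes V. 1))"
  proof (rule sum_mono)
    fix z assume z: "z \<in> X"
    then have "fst z \<in> E" "snd z \<in> E" "snd z \<noteq> fst z" by (auto simp: X_def)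
    moreover have "card (ends (fst z)) \<le> 9" using card_ends_le[of "fst z"] by simp
    ultimately show "(\<Sum>p | p permutes V. 1 * of_bool (blk p (snd z) = blk p (fst z)))
      \<le> 2 * B / n * (\<Sum>p | p permutes V. 1)"
      using ends_E E_subset by (intro sum_same_block_le[where P = "ends (fst z)"] depends_on_const depends_on_blk blk_bounds)
        (auto simp: ends_subset_iff)
  qed
  also have "\<dots> = real (card X) * (2 * B / n * fact (card V))"
    by (simp add: card_permutations finite_V)
  also have "\<dots> \<le> (n * k) * (2 * k) * (2 * B / n * fact (card V))"
    by (intro mult_right_mono cX) auto
  also have "\<dots> = 4 * k\<^sup>2 * B * fact (card V)"
    using n_ge by (simp add: field_simps power2_eq_square)
  finally show ?thesis .
qed

text \<open>Up to \<open>(n * k)\<^sup>2\<close> pairs pay \<open>(2 * B / n)\<^sup>2\<close> each.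
  The result is quadratic in \<open>B\<close>, hence not small against a single squared factor
  \<open>1/(q - 1)\<close>.\<close>

lemma sum_disjoint_same_pairs_le:
  "(\<Sum>p | p permutes V. real (card (disjoint_same_pairs p))) \<le> 4 * k\<^sup>2 * B\<^sup>2 * fact (card V)"
proof -
  define X where "X = {(e, e') \<in> E \<times> E. ends e \<inter> ends e' = {}}"
  have fX: "finite X" unfolding X_def using finite_E by (auto intro: finite_subset[of _ "E \<times> E"])
  have "card X \<le> card (E \<times> E)" using finite_E by (intro card_mono) (auto simp: X_def)
  then have "real (card X) \<le> real (card E) * real (card E)" by (metis card_cartesian_product of_nat_le_iff of_nat_mult)
  also have "\<dots> \<le> (n * k) * (n * k)" by (intro mult_mono card_E_le) auto
  finally have cX: "real (card X) \<le> (n * k) * (n * k)" .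
  have "(\<Sum>p | p permutes V. real (card (disjoint_same_pairs p)))
     = (\<Sum>p | p permutes V. \<Sum>z\<in>X. of_bool (blk p (snd z) = blk p (fst z)))"
  proof (rule sum.cong[OF refl])
    fix p
    have "disjoint_same_pairs p = {z \<in> X. blk p (snd z) = blk p (fst z)}"
      unfolding disjoint_same_pairs_def same_pairs_def X_def by (auto simp: ends_def)
    then show "real (card (disjoint_same_pairs p)) = (\<Sum>z\<in>X. of_bool (blk p (snd z) = blk p (fst z)))"
      using fX by (simp only: card_eq_sum_of_bool)
  qed
  also have "\<dots> = (\<Sum>z\<in>X. \<Sum>p | p permutes V. 1 * of_bool (blk p (snd z) = blk p (fst z)))"
    by (subst sum.swap) simp
  also have "\<dots> \<le> (\<Sum>z\<in>X. (2 * B / n)\<^sup>2 * (\<Sum>p | p permutes V. 1))"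
  proof (rule sum_mono)
    fix z assume z: "z \<in> X"
    then have "fst z \<in> E" "snd z \<in> E" "ends (snd z) \<inter> ends (fst z) = {}" by (auto simp: X_def)
    moreover have "card (ends (fst z)) \<le> 8" using card_ends_le[of "fst z"] by simp
    ultimately show "(\<Sum>p | p permutes V. 1 * of_bool (blk p (snd z) = blk p (fst z)))
      \<le> (2 * B / n)\<^sup>2 * (\<Sum>p | p permutes V. 1)"
      using ends_E E_subset
      by (intro sum_same_block_disjoint_le[where P = "ends (fst z)"] depends_on_const depends_on_blk blk_bounds) auto
  qed
  also have "\<dots> = real (card X) * ((2 * B / n)\<^sup>2 * fact (card V))"
    by (simp add: card_permutations finite_V)
  also have "\<dots> \<le> (n * k) * (n * k) * ((2 * B / n)\<^sup>2 * fact (card V))"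
    by (intro mult_right_mono cX) auto
  also have "\<dots> = 4 * k\<^sup>2 * B\<^sup>2 * fact (card V)"
    using n_ge by (simp add: field_simps power2_eq_square)
  finally show ?thesis .
qed

section \<open>Rare configurations\<close>

definition internal_pairs :: "('a \<Rightarrow> 'a) \<Rightarrow> (('a \<times> 'a) \<times> ('a \<times> 'a)) set" where
  "internal_pairs p = {(e, e') \<in> same_pairs p. card (blk p e) \<le> 1}"

text \<open>The third arc must bring a new vertex, or it would cost no further factor
  \<open>1/n\<close>. Triangles of \<open>H\<close> are thus left out; they cannot occur in a pair
  block, which is bipartite, and in an internal block they already produce internal pairs.\<close>

definition same_triples :: "('a \<Rightarrow> 'a) \<Rightarrow> (('a \<times> 'a) \<times> ('a \<times> 'a) \<times> ('a \<times> 'a)) set" where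
  "same_triples p = {(e\<^sub>1, e\<^sub>2, e\<^sub>3) \<in> E \<times> E \<times> E.
     (e\<^sub>1, e\<^sub>2) \<in> same_pairs p \<and> \<not> ends e\<^sub>3 \<subseteq> ends e\<^sub>1 \<union> ends e\<^sub>2 \<and> blk p e\<^sub>3 = blk p e\<^sub>1}"

text \<open>A count in place of an indicator: it is at least \<open>1\<close> on every bad
  \<open>p\<close>, and it is a sum of indicators that each depend on at most six images, so
  weighted sums can be treated term by term.\<close>

definition bad_count :: "('a \<Rightarrow> 'a) \<Rightarrow> real" where
  "bad_count p = card (internal_pairs p) + card (same_triples p)"

lemma sum_internal_arc_le:
  assumes e: "e \<in> E"
  shows "(\<Sum>p | p permutes V. of_bool (card (blk p e) \<le> 1)) \<le> 4 * B / n * fact (card V)"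
proof -
  define u v where "u = fst e" and "v = snd e"
  have "(u, v) \<in> E" using e by (simp add: u_def v_def)
  then have uv: "u \<in> V" "v \<in> V" "u \<noteq> v"
    using E_subset asym[of u v] by auto
  \<comment> \<open>If \<open>p u\<close> has no cluster, every arc at \<open>u\<close> within one
    cluster is internal, so that case is counted separately; without the condition
    \<open>K (p u) \<noteq> {}\<close> the set would then be too large for the bound
    \<open>B\<close>.\<close>
  define S where "S p = {w. K (p u) \<noteq> {} \<and> card (K (p u) \<union> K w) \<le> 1}" for p
  have "(\<Sum>p | p permutes V. of_bool (card (blk p e) \<le> 1) :: real)
    \<le> (\<Sum>p | p permutes V. 1 * of_bool (p u \<in> {w. K w \<subseteq> {}}) + 1 * of_bool (p v \<in> S p))"
    by (intro sum_mono) (auto simp: block_def S_def u_def v_def)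
  also have "\<dots> = (\<Sum>p | p permutes V. 1 * of_bool (p u \<in> {w. K w \<subseteq> {}})) + (\<Sum>p | p permutes V. 1 * of_bool (p v \<in> S p))"
    by (rule sum.distrib)
  also have "\<dots> \<le> 2 * B / n * (\<Sum>p | p permutes V. 1) + 2 * B / n * (\<Sum>p | p permutes V. 1)"
  proof (intro add_mono)
    show "(\<Sum>p | p permutes V. 1 * of_bool (p u \<in> {w. K w \<subseteq> {}})) \<le> 2 * B / n * (\<Sum>p | p permutes V. 1)"
      using uv card_below[of "{}"] by (intro sum_hit[where P = "{}"] depends_on_const) auto
    show "(\<Sum>p | p permutes V. 1 * of_bool (p v \<in> S p)) \<le> 2 * B / n * (\<Sum>p | p permutes V. 1)"
    proof (rule sum_hit[where P = "{u}"])
      show "depends_on {u} S" unfolding depends_on_def S_def by auto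
      fix p assume p: "p permutes V"
      then have pu: "p u \<in> V" using uv permutes_in_image by metis
      have "{w \<in> V. w \<in> S p} \<subseteq> {w \<in> V. K w \<subseteq> K (p u)}"
      proof
        fix w assume w: "w \<in> {w \<in> V. w \<in> S p}"
        then obtain i where "K (p u) = {i}" using K_cases[OF pu] by (auto simp: S_def)
        then show "w \<in> {w \<in> V. K w \<subseteq> K (p u)}"
          using w K_cases[of w] by (auto simp: S_def card_insert_if split: if_splits)
      qed
      then have "card {w \<in> V. w \<in> S p} \<le> card {w \<in> V. K w \<subseteq> K (p u)}"
        using finite_V by (intro card_mono) auto
      also have "\<dots> \<le> B" using K_cases[OF pu] by (intro card_below) auto
      finally show "card {w \<in> V. w \<in> S p} \<le> B" .
    qed (use uv in \<open>auto simp: depends_on_const\<close>)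
  qed
  finally show ?thesis by (simp add: card_permutations finite_V)
qed

text \<open>An arc is internal with probability \<open>O(1/n)\<close>, and a second arc joins it at
  the cost of another \<open>C / n\<close>; only one of these factors is absorbed by the number of
  first arcs.\<close>

lemma sum_internal_pairs_le:
  "(\<Sum>p | p permutes V. real (card (internal_pairs p))) \<le> 4 * k * B * C / n * fact (card V)"
proof -
  let ?N = "\<lambda>p e. {e' \<in> E. \<not> ends e' \<subseteq> ends e \<and> blk p e' = blk p e}"
  have "(\<Sum>p | p permutes V. real (card (internal_pairs p)))
     = (\<Sum>p | p permutes V. \<Sum>e\<in>E. of_bool (card (blk p e) \<le> 1) * real (card (?N p e)))"
  proof (rule sum.cong[OF refl])
    fix p
    have "internal_pairs p = Sigma {e \<in> E. card (blk p e) \<le> 1} (?N p)"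
      unfolding internal_pairs_def same_pairs_def by (auto simp: ends_subset_iff)
    then have "real (card (internal_pairs p)) = (\<Sum>e\<in>{e \<in> E. card (blk p e) \<le> 1}. real (card (?N p e)))"
      using finite_E by simp
    also have "\<dots> = (\<Sum>e\<in>E. of_bool (card (blk p e) \<le> 1) * real (card (?N p e)))"
      using finite_E by (intro sum.mono_neutral_cong_left) auto
    finally show "real (card (internal_pairs p)) = \<dots>" .
  qed
  also have "\<dots> = (\<Sum>e\<in>E. \<Sum>p | p permutes V. of_bool (card (blk p e) \<le> 1) * real (card (?N p e)))"
    by (rule sum.swap)
  also have "\<dots> \<le> (\<Sum>e\<in>E. C / n * (4 * B / n * fact (card V)))"
  proof (rule sum_mono)
    fix e assume e: "e \<in> E"
    have c8: "card (ends e) \<le> 8" using card_ends_le[of e] by simp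
    have "(\<Sum>p | p permutes V. of_bool (card (blk p e) \<le> 1) * real (card (?N p e)))
      \<le> C / n * (\<Sum>p | p permutes V. of_bool (card (blk p e) \<le> 1))"
    proof (rule sum_new_arcs_le[OF ends_E[OF e] c8])
      show "depends_on (ends e) (\<lambda>p. of_bool (card (blk p e) \<le> 1))"
        using depends_on_blk[of e "ends e"] unfolding depends_on_def by (metis order_refl)
    qed (use e E_subset depends_on_blk blk_bounds in auto)
    also have "\<dots> \<le> C / n * (4 * B / n * fact (card V))"
      using C_nonneg by (intro mult_left_mono sum_internal_arc_le e) auto
    finally show "(\<Sum>p | p permutes V. of_bool (card (blk p e) \<le> 1) * real (card (?N p e)))
      \<le> C / n * (4 * B / n * fact (card V))" .
  qed
  also have "\<dots> = real (card E) * (C / n * (4 * B / n * fact (card V)))" by simp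
  also have "\<dots> \<le> (n * k) * (C / n * (4 * B / n * fact (card V)))"
    using C_nonneg by (intro mult_right_mono card_E_le) auto
  also have "\<dots> = 4 * k * B * C / n * fact (card V)" using n_ge by (simp add: field_simps)
  finally show ?thesis .
qed

text \<open>\<open>sum_new_arcs_le\<close> is applied twice: to the third arc given the first two,
  then to the second given the first. Of the two factors \<open>C / n\<close>, the number of first
  arcs absorbs one.\<close>

lemma sum_same_triples_le:
  "(\<Sum>p | p permutes V. real (card (same_triples p))) \<le> k * C\<^sup>2 / n * fact (card V)"
proof -
  let ?N = "\<lambda>p e e'. {e'' \<in> E. \<not> ends e'' \<subseteq> ends e \<union> ends e' \<and> blk p e'' = blk p e}"
  let ?M = "\<lambda>p e. {e' \<in> E. \<not> ends e' \<subseteq> ends e \<and> blk p e' = blk p e}"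
  define X where "X e = E - {e}" for e
  have fX: "finite (X e)" for e unfolding X_def using finite_E by auto
  have "(\<Sum>p | p permutes V. real (card (same_triples p)))
     = (\<Sum>p | p permutes V. \<Sum>e\<in>E. \<Sum>e'\<in>X e. of_bool (blk p e' = blk p e) * real (card (?N p e e')))"
  proof (rule sum.cong[OF refl])
    fix p
    have eq: "same_triples p = Sigma E (\<lambda>e. Sigma {e' \<in> X e. blk p e' = blk p e} (?N p e))"
      unfolding same_triples_def same_pairs_def X_def by auto
    have "real (card (same_triples p)) = (\<Sum>e\<in>E. \<Sum>e'\<in>{e' \<in> X e. blk p e' = blk p e}. real (card (?N p e e')))"
      unfolding eq using finite_E fX by simp
    also have "\<dots> = (\<Sum>e\<in>E. \<Sum>e'\<in>X e. of_bool (blk p e' = blk p e) * real (card (?N p e e')))"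
      using fX by (intro sum.cong[OF refl] sum.mono_neutral_cong_left) auto
    finally show "real (card (same_triples p)) = \<dots>" .
  qed
  also have "\<dots> = (\<Sum>e\<in>E. \<Sum>e'\<in>X e. \<Sum>p | p permutes V. of_bool (blk p e' = blk p e) * real (card (?N p e e')))"
    by (subst sum.swap, rule sum.cong[OF refl], rule sum.swap)
  also have "\<dots> \<le> (\<Sum>e\<in>E. \<Sum>e'\<in>X e. C / n * (\<Sum>p | p permutes V. of_bool (blk p e' = blk p e)))"
  proof (intro sum_mono)
    fix e e' assume e: "e \<in> E" "e' \<in> X e"
    then have e': "e' \<in> E" by (simp add: X_def)
    have c8: "card (ends e \<union> ends e') \<le> 8"
      using card_Un_le[of "ends e" "ends e'"] card_ends_le[of e] card_ends_le[of e'] by linarith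
    show "(\<Sum>p | p permutes V. of_bool (blk p e' = blk p e) * real (card (?N p e e')))
      \<le> C / n * (\<Sum>p | p permutes V. of_bool (blk p e' = blk p e))"
    proof (rule sum_new_arcs_le[OF _ c8])
      show "depends_on (ends e \<union> ends e') (\<lambda>p. of_bool (blk p e' = blk p e))"
        using depends_on_blk[of e "ends e \<union> ends e'"] depends_on_blk[of e' "ends e \<union> ends e'"]
        unfolding depends_on_def by (metis Un_upper1 Un_upper2)
    qed (use e e' ends_E E_subset depends_on_blk[of e "ends e \<union> ends e'"] blk_bounds in auto)
  qed
  also have "\<dots> = (\<Sum>e\<in>E. C / n * (\<Sum>p | p permutes V. 1 * real (card (?M p e))))"
  proof (rule sum.cong[OF refl])
    fix e assume e: "e \<in> E"
    have "(\<Sum>e'\<in>X e. \<Sum>p | p permutes V. of_bool (blk p e' = blk p e)) = (\<Sum>p | p permutes V. 1 * real (card (?M p e)))"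
    proof (subst sum.swap, rule sum.cong[OF refl])
      fix p
      have "?M p e = {e' \<in> X e. blk p e' = blk p e}" using e unfolding X_def by (auto simp: ends_subset_iff)
      then show "(\<Sum>e'\<in>X e. of_bool (blk p e' = blk p e)) = 1 * real (card (?M p e))"
        by (simp only: card_eq_sum_of_bool[OF fX] mult_1)
    qed
    then show "(\<Sum>e'\<in>X e. C / n * (\<Sum>p | p permutes V. of_bool (blk p e' = blk p e))) = C / n * (\<Sum>p | p permutes V. 1 * real (card (?M p e)))"
      by (simp only: sum_distrib_left[symmetric])
  qed
  also have "\<dots> \<le> (\<Sum>e\<in>E. C / n * (C / n * (\<Sum>p | p permutes V. 1)))"
  proof (intro sum_mono mult_left_mono)
    fix e assume e: "e \<in> E"
    have c8: "card (ends e) \<le> 8" using card_ends_le[of e] by simp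
    show "(\<Sum>p | p permutes V. 1 * real (card (?M p e))) \<le> C / n * (\<Sum>p | p permutes V. 1)"
      by (rule sum_new_arcs_le[OF ends_E[OF e] c8])
        (use e E_subset depends_on_blk blk_bounds in \<open>auto simp: depends_on_const\<close>)
  qed (use C_nonneg in auto)
  also have "\<dots> = real (card E) * (C / n * (C / n * fact (card V)))"
    by (simp add: card_permutations finite_V)
  also have "\<dots> \<le> (n * k) * (C / n * (C / n * fact (card V)))"
    using C_nonneg by (intro mult_right_mono card_E_le) auto
  also have "\<dots> = k * C\<^sup>2 / n * fact (card V)" using n_ge by (simp add: field_simps power2_eq_square)
  finally show ?thesis .
qed

lemma sum_bad_count_le:
  "(\<Sum>p | p permutes V. bad_count p) \<le> (4 * k * B * C + k * C\<^sup>2) / n * fact (card V)"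
  using sum_internal_pairs_le sum_same_triples_le
  by (simp add: bad_count_def sum.distrib add_divide_distrib distrib_right)

text \<open>A bad configuration lives on at most six vertices, so conditioning on it leaves the expected
  number of pairs in a common block bounded.\<close>

lemma sum_bad_count_same_pairs_le:
  "(\<Sum>p | p permutes V. bad_count p * real (card (same_pairs p)))
    \<le> (36 * k\<^sup>2 + 2 * k * C) * (\<Sum>p | p permutes V. bad_count p)"
proof -
  let ?D = "36 * k\<^sup>2 + 2 * k * C"
  let ?W = "\<lambda>p. real (card (same_pairs p))"
  define I where "I p z \<longleftrightarrow> z \<in> internal_pairs p" for p and z :: "('a \<times> 'a) \<times> ('a \<times> 'a)"
  define T where "T p z \<longleftrightarrow> z \<in> same_triples p" for p and z :: "('a \<times> 'a) \<times> ('a \<times> 'a) \<times> ('a \<times> 'a)"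
  have bad: "bad_count p = (\<Sum>z\<in>E \<times> E. of_bool (I p z)) + (\<Sum>z\<in>E \<times> E \<times> E. of_bool (T p z))" for p
  proof -
    have "internal_pairs p = {z \<in> E \<times> E. I p z}" "same_triples p = {z \<in> E \<times> E \<times> E. T p z}"
      unfolding I_def T_def internal_pairs_def same_triples_def same_pairs_def by auto
    then show ?thesis unfolding bad_count_def
      using finite_E by (simp only: card_eq_sum_of_bool finite_cartesian_product of_nat_add)
  qed
  have I: "(\<Sum>p | p permutes V. of_bool (I p z) * ?W p) \<le> ?D * (\<Sum>p | p permutes V. of_bool (I p z))"
    if zE: "z \<in> E \<times> E" for z
  proof -
    obtain e e' where z: "z = (e, e')" "e \<in> E" "e' \<in> E" using zE by (metis mem_Times_iff prod.collapse)
    let ?P = "ends e \<union> ends e'"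
    have c6: "card ?P \<le> 6"
      using card_Un_le[of "ends e" "ends e'"] card_ends_le[of e] card_ends_le[of e'] by linarith
    show ?thesis
    proof (rule sum_same_pairs_le[OF _ c6])
      have *: "blk p e = blk p' e" "blk p e' = blk p' e'" if "\<forall>v\<in>?P. p v = p' v" for p p'
        using that by (auto simp: ends_def block_def)
      show "depends_on ?P (\<lambda>p. of_bool (I p z))"
        unfolding depends_on_def
      proof (intro allI impI)
        fix p p' :: "'a \<Rightarrow> 'a" assume "\<forall>v\<in>?P. p v = p' v"
        from *[OF this] show "of_bool (I p z) = of_bool (I p' z)"
          by (simp add: I_def internal_pairs_def same_pairs_def z(1))
      qed
    qed (use z ends_E in auto)
  qed
  have T: "(\<Sum>p | p permutes V. of_bool (T p z) * ?W p) \<le> ?D * (\<Sum>p | p permutes V. of_bool (T p z))"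
    if zE: "z \<in> E \<times> E \<times> E" for z
  proof -
    obtain e e' e'' where z: "z = (e, e', e'')" "e \<in> E" "e' \<in> E" "e'' \<in> E" using zE by (metis mem_Times_iff prod.collapse)
    let ?P = "ends e \<union> ends e' \<union> ends e''"
    have c6: "card ?P \<le> 6"
      using card_Un_le[of "ends e \<union> ends e'" "ends e''"] card_Un_le[of "ends e" "ends e'"]
        card_ends_le[of e] card_ends_le[of e'] card_ends_le[of e''] by linarith
    show ?thesis
    proof (rule sum_same_pairs_le[OF _ c6])
      have *: "blk p e = blk p' e" "blk p e' = blk p' e'" "blk p e'' = blk p' e''" if "\<forall>v\<in>?P. p v = p' v" for p p'
        using that by (auto simp: ends_def block_def)
      show "depends_on ?P (\<lambda>p. of_bool (T p z))"
        unfolding depends_on_def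
      proof (intro allI impI)
        fix p p' :: "'a \<Rightarrow> 'a" assume "\<forall>v\<in>?P. p v = p' v"
        from *[OF this] show "of_bool (T p z) = of_bool (T p' z)"
          by (simp add: T_def same_triples_def same_pairs_def z(1))
      qed
    qed (use z ends_E in auto)
  qed
  have "(\<Sum>p | p permutes V. bad_count p * ?W p) =
      (\<Sum>z\<in>E \<times> E. \<Sum>p | p permutes V. of_bool (I p z) * ?W p) +
      (\<Sum>z\<in>E \<times> E \<times> E. \<Sum>p | p permutes V. of_bool (T p z) * ?W p)"
    unfolding bad distrib_right sum.distrib sum_distrib_right
    by (intro arg_cong2[of _ _ _ _ "(+)"] sum.swap)
  also have "\<dots> \<le> (\<Sum>z\<in>E \<times> E. ?D * (\<Sum>p | p permutes V. of_bool (I p z))) +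
      (\<Sum>z\<in>E \<times> E \<times> E. ?D * (\<Sum>p | p permutes V. of_bool (T p z)))"
    by (intro add_mono sum_mono I T)
  also have "\<dots> = ?D * ((\<Sum>z\<in>E \<times> E. \<Sum>p | p permutes V. of_bool (I p z)) +
      (\<Sum>z\<in>E \<times> E \<times> E. \<Sum>p | p permutes V. of_bool (T p z)))"
    by (simp only: sum_distrib_left distrib_left)
  also have "(\<Sum>z\<in>E \<times> E. \<Sum>p | p permutes V. of_bool (I p z)) + (\<Sum>z\<in>E \<times> E \<times> E. \<Sum>p | p permutes V. of_bool (T p z))
      = (\<Sum>p | p permutes V. bad_count p)"
    unfolding bad sum.distrib by (intro arg_cong2[of _ _ _ _ "(+)"] sum.swap)
  finally show ?thesis .
qed

end

section \<open>Balanced orientations of a block\<close>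

context clustering
begin

definition positions :: "('a \<times> 'a) set" where
  "positions = {z \<in> V \<times> V. fst z \<noteq> snd z}"

definition blocks :: "nat set set" where
  "blocks = block ` positions"

text \<open>The row sums run over all of \<open>V\<close>, but the entries vanish off the block. So
  each vertex is balanced inside the block, and adding up blocks keeps all rows at zero.\<close>

definition balanced :: "nat set \<Rightarrow> ('a \<times> 'a \<Rightarrow> real) set" where
  "balanced \<beta> = {d. (\<forall>z. z \<in> positions \<and> block z = \<beta> \<longrightarrow> d z = 1 \<or> d z = -1) \<and>
     (\<forall>z. \<not> (z \<in> positions \<and> block z = \<beta>) \<longrightarrow> d z = 0) \<and>
     (\<forall>u v. d (v, u) = - d (u, v)) \<and> (\<forall>u\<in>V. (\<Sum>v\<in>V. d (u, v)) = 0)}"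

text \<open>By \<open>sum_balanced\<close> every entry has mean zero, so this mean of products is a
  covariance under the uniform distribution on balanced orientations.\<close>

definition corr :: "nat set \<Rightarrow> 'a \<times> 'a \<Rightarrow> 'a \<times> 'a \<Rightarrow> real" where
  "corr \<beta> z z' = (\<Sum>d\<in>balanced \<beta>. d z * d z') / card (balanced \<beta>)"

lemma balancedI:
  assumes "\<And>z. z \<in> positions \<Longrightarrow> block z = \<beta> \<Longrightarrow> d z = 1 \<or> d z = -1"
    and "\<And>z. \<not> (z \<in> positions \<and> block z = \<beta>) \<Longrightarrow> d z = 0"
    and "\<And>u v. d (v, u) = - d (u, v)"
    and "\<And>u. u \<in> V \<Longrightarrow> (\<Sum>v\<in>V. d (u, v)) = 0"
  shows "d \<in> balanced \<beta>"
  unfolding balanced_def mem_Collect_eq using assms by blast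

lemma balancedD:
  assumes "d \<in> balanced \<beta>"
  shows "z \<in> positions \<Longrightarrow> block z = \<beta> \<Longrightarrow> d z = 1 \<or> d z = -1"
    and "\<not> (z \<in> positions \<and> block z = \<beta>) \<Longrightarrow> d z = 0"
    and "d (v, u) = - d (u, v)"
    and "u \<in> V \<Longrightarrow> (\<Sum>v\<in>V. d (u, v)) = 0"
  using assms unfolding balanced_def mem_Collect_eq by blast+

lemma finite_positions: "finite positions"
  unfolding positions_def using finite_V by auto

lemma finite_blocks: "finite blocks"
  unfolding blocks_def using finite_positions by simp

lemma finite_balanced: "finite (balanced \<beta>)"
proof (rule finite_subset)
  show "balanced \<beta> \<subseteq> {d. \<forall>z. (z \<in> positions \<longrightarrow> d z \<in> {-1, 0, 1}) \<and> (z \<notin> positions \<longrightarrow> d z = 0)}"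
    using balancedD(1,2) by fastforce
  show "finite {d :: 'a \<times> 'a \<Rightarrow> real. \<forall>z. (z \<in> positions \<longrightarrow> d z \<in> {-1, 0, 1}) \<and> (z \<notin> positions \<longrightarrow> d z = 0)}"
    using finite_positions by (intro finite_set_of_finite_funs) auto
qed

lemma abs_balanced_le: "d \<in> balanced \<beta> \<Longrightarrow> \<bar>d z\<bar> \<le> 1"
  using balancedD(1,2)[of d \<beta> z] by fastforce

lemma balanced_uminus:
  assumes d: "d \<in> balanced \<beta>"
  shows "(\<lambda>z. - d z) \<in> balanced \<beta>"
proof (rule balancedI)
  show "- d z = 1 \<or> - d z = -1" if "z \<in> positions" "block z = \<beta>" for z
    using balancedD(1)[OF d that] by auto
  show "- d z = 0" if "\<not> (z \<in> positions \<and> block z = \<beta>)" for z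
    using balancedD(2)[OF d that] by simp
  show "- d (v, u) = - (- d (u, v))" for u v
    using balancedD(3)[OF d, of v u] by simp
  show "(\<Sum>v\<in>V. - d (u, v)) = 0" if "u \<in> V" for u
    using balancedD(4)[OF d that] by (simp add: sum_negf)
qed

lemma sum_balanced: "(\<Sum>d\<in>balanced \<beta>. d z) = 0"
proof -
  have "(\<Sum>d\<in>balanced \<beta>. d z) = (\<Sum>d\<in>balanced \<beta>. - d z)"
    by (rule sum.reindex_bij_witness[of _ "\<lambda>d z. - d z" "\<lambda>d z. - d z"]) (auto intro: balanced_uminus)
  then show ?thesis by (simp add: sum_negf)
qed

text \<open>Exchanging two vertices of one cluster maps every block to itself. This exchangeability
  replaces any explicit enumeration of balanced orientations.\<close>

lemma balanced_transpose:
  assumes a: "a \<in> V" "b \<in> V" "K a = K b" and d: "d \<in> balanced \<beta>"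
  shows "d \<circ> map_prod (transpose a b) (transpose a b) \<in> balanced \<beta>"
proof -
  let ?t = "transpose a b"
  have t: "?t permutes V" using a by (simp add: permutes_swap_id)
  have K: "K (?t w) = K w" for w using a by (simp add: transpose_def)
  have pos: "map_prod ?t ?t z \<in> positions \<longleftrightarrow> z \<in> positions" for z
    using permutes_in_image[OF t] by (cases z) (auto simp: positions_def transpose_eq_iff)
  have blk: "block (map_prod ?t ?t z) = block z" for z by (simp add: block_def K)
  show ?thesis
  proof (rule balancedI)
    show "(d \<circ> map_prod ?t ?t) z = 1 \<or> (d \<circ> map_prod ?t ?t) z = -1"
      if "z \<in> positions" "block z = \<beta>" for z
      using balancedD(1)[OF d, of "map_prod ?t ?t z"] that by (simp add: pos blk)
    show "(d \<circ> map_prod ?t ?t) z = 0" if "\<not> (z \<in> positions \<and> block z = \<beta>)" for z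
      using balancedD(2)[OF d, of "map_prod ?t ?t z"] that by (simp add: pos blk)
    show "(d \<circ> map_prod ?t ?t) (v, u) = - (d \<circ> map_prod ?t ?t) (u, v)" for u v
      using balancedD(3)[OF d, of "?t v" "?t u"] by simp
    show "(\<Sum>v\<in>V. (d \<circ> map_prod ?t ?t) (u, v)) = 0" if "u \<in> V" for u
    proof -
      have "(\<Sum>v\<in>V. (d \<circ> map_prod ?t ?t) (u, v)) = (\<Sum>v\<in>V. d (?t u, v))"
        using sum.permute[OF t, of "\<lambda>y. d (?t u, y)"] by (simp add: o_def)
      also have "\<dots> = 0" using permutes_in_image[OF t] that by (intro balancedD(4)[OF d]) auto
      finally show ?thesis .
    qed
  qed
qed

lemma sum_balanced_transpose:
  assumes "a \<in> V" "b \<in> V" "K a = K b"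
  shows "(\<Sum>d\<in>balanced \<beta>. f (d \<circ> map_prod (transpose a b) (transpose a b))) = (\<Sum>d\<in>balanced \<beta>. f d)"
proof -
  have inv: "d \<circ> map_prod (transpose a b) (transpose a b) \<circ> map_prod (transpose a b) (transpose a b) = d"
    for d :: "'a \<times> 'a \<Rightarrow> real"
    by (rule ext) (simp add: map_prod_def split_beta)
  show ?thesis
    by (rule sum.reindex_bij_witness[of _ "\<lambda>d. d \<circ> map_prod (transpose a b) (transpose a b)"
      "\<lambda>d. d \<circ> map_prod (transpose a b) (transpose a b)"]) (use inv assms in \<open>auto intro: balanced_transpose\<close>)
qed

text \<open>The row of \<open>w\<close> sums to zero over cluster \<open>j\<close>. Exchanging
  vertices of cluster \<open>j\<close> fixes \<open>w\<close> and \<open>w'\<close>, so all entries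
  of this row except the one at \<open>a\<close> have the same correlation with
  \<open>(w', a)\<close> and share equally in cancelling that one. The case \<open>w' = w\<close> is
  included.\<close>

lemma sum_balanced_row:
  assumes w: "w \<in> V" "w' \<in> V" "K w = {i}" "K w' = {i}"
    and ab: "a \<in> V" "b \<in> V" "a \<noteq> b" "K a = {j}" "K b = {j}" and ij: "i \<noteq> j"
  shows "(real (card {y \<in> V. K y = {j}}) - 1) * (\<Sum>d\<in>balanced {i, j}. d (w', a) * d (w, b))
    = - (\<Sum>d\<in>balanced {i, j}. d (w', a) * d (w, a))"
proof -
  let ?D = "balanced {i, j}" and ?Y = "{y \<in> V. K y = {j}}"
  define X where "X y = (\<Sum>d\<in>?D. d (w', a) * d (w, y))" for y
  have Xb: "X y = X b" if y: "y \<in> ?Y - {a}" for y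
  proof -
    let ?t = "transpose y b"
    have t: "?t w = w" "?t w' = w'" "?t a = a" "?t y = b" using w ab y ij by (auto simp: transpose_def)
    have "X y = (\<Sum>d\<in>?D. (\<lambda>d. d (w', a) * d (w, y)) (d \<circ> map_prod ?t ?t))"
      unfolding X_def using y ab by (intro sum_balanced_transpose[symmetric]) auto
    also have "\<dots> = X b" unfolding X_def by (simp add: t)
    finally show ?thesis .
  qed
  have zero: "d (w, y) = 0" if "d \<in> ?D" "y \<in> V - ?Y" for d y
    using that w K_cases[of y] ij by (intro balancedD(2)[OF that(1)]) (auto simp: block_def)
  have "(\<Sum>y\<in>?Y. X y) = (\<Sum>d\<in>?D. d (w', a) * (\<Sum>y\<in>?Y. d (w, y)))"
    unfolding X_def by (subst sum.swap) (simp add: sum_distrib_left)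
  also have "\<dots> = (\<Sum>d\<in>?D. d (w', a) * (\<Sum>y\<in>V. d (w, y)))"
    using finite_V zero by (intro sum.cong[OF refl] arg_cong2[of _ _ _ _ "(*)"] refl sum.mono_neutral_left) auto
  also have "\<dots> = 0"
    using balancedD(4) w by (intro sum.neutral) auto
  finally have "(\<Sum>y\<in>?Y. X y) = 0" .
  moreover have "(\<Sum>y\<in>?Y. X y) = X a + (\<Sum>y\<in>?Y - {a}. X y)"
    using ab finite_V by (intro sum.remove) auto
  moreover have "(\<Sum>y\<in>?Y - {a}. X y) = (\<Sum>y\<in>?Y - {a}. X b)"
    by (rule sum.cong[OF refl]) (rule Xb)
  moreover have "real (card (?Y - {a})) = real (card ?Y) - 1"
  proof -
    have "card (?Y - {a}) = card ?Y - 1" "card ?Y > 0" using ab finite_V by (auto simp: card_gt_0_iff)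
    then show ?thesis by (simp add: of_nat_diff)
  qed
  ultimately show ?thesis unfolding X_def by simp
qed

lemma corr_commute: "corr \<beta> z z' = corr \<beta> z' z"
  by (simp add: corr_def mult.commute)

lemma corr_swap: "corr \<beta> z (prod.swap z') = - corr \<beta> z z'"
proof -
  have "(\<Sum>d\<in>balanced \<beta>. d z * d (prod.swap z')) = (\<Sum>d\<in>balanced \<beta>. - (d z * d z'))"
  proof (rule sum.cong[OF refl])
    fix d assume "d \<in> balanced \<beta>"
    from balancedD(3)[OF this, of "snd z'" "fst z'"] show "d z * d (prod.swap z') = - (d z * d z')"
      by (simp add: prod.swap_def)
  qed
  then show ?thesis by (simp add: corr_def sum_negf)
qed

lemma abs_corr_le_1: "\<bar>corr \<beta> z z'\<bar> \<le> 1"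
proof (cases "card (balanced \<beta>) = 0")
  case False
  have "\<bar>\<Sum>d\<in>balanced \<beta>. d z * d z'\<bar> \<le> (\<Sum>d\<in>balanced \<beta>. 1)"
  proof (rule order_trans[OF sum_abs], rule sum_mono)
    fix d assume "d \<in> balanced \<beta>"
    then show "\<bar>d z * d z'\<bar> \<le> 1" using abs_balanced_le[of d \<beta>] by (simp add: abs_mult mult_le_one)
  qed
  then show ?thesis using False by (simp add: corr_def)
qed (simp add: corr_def)

lemma abs_corr_row:
  assumes w: "w \<in> V" "w' \<in> V" "K w = {i}" "K w' = {i}"
    and ab: "a \<in> V" "b \<in> V" "a \<noteq> b" "K a = {j}" "K b = {j}" and ij: "i \<noteq> j" and q: "q > 1"
  shows "\<bar>corr {i, j} (w', a) (w, b)\<bar> \<le> \<bar>corr {i, j} (w', a) (w, a)\<bar> / (real q - 1)"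
proof -
  let ?c = "real (card {y \<in> V. K y = {j}}) - 1"
  let ?N = "real (card (balanced {i, j}))"
  have c: "real q - 1 \<le> ?c" using cluster_size[OF ab(1,4)] by simp
  have "?c * corr {i, j} (w', a) (w, b) = - corr {i, j} (w', a) (w, a)"
    using arg_cong[OF sum_balanced_row[OF w ab ij], of "\<lambda>x. x / ?N"] by (simp add: corr_def)
  then have "\<bar>?c\<bar> * \<bar>corr {i, j} (w', a) (w, b)\<bar> = \<bar>corr {i, j} (w', a) (w, a)\<bar>"
    by (simp add: abs_mult[symmetric])
  moreover have "\<bar>?c\<bar> = ?c" using c q by simp
  moreover have "(real q - 1) * \<bar>corr {i, j} (w', a) (w, b)\<bar> \<le> ?c * \<bar>corr {i, j} (w', a) (w, b)\<bar>"
    using c by (intro mult_right_mono) auto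
  ultimately show ?thesis using q by (simp add: field_simps)
qed

text \<open>Moving the head from \<open>a\<close> to \<open>b\<close> gains a factor
  \<open>1/(q - 1)\<close> by the row argument; the row argument for the reversed arcs does the same
  for the tails. Arcs that differ in both ends gain it twice.\<close>

lemma abs_corr_oriented:
  assumes w: "w \<in> V" "w' \<in> V" "K w = {i}" "K w' = {i}"
    and ab: "a \<in> V" "b \<in> V" "K a = {j}" "K b = {j}" and ij: "i \<noteq> j" and q: "q > 1"
  shows "(w', a) \<noteq> (w, b) \<Longrightarrow> \<bar>corr {i, j} (w', a) (w, b)\<bar> \<le> 1 / (real q - 1)"
    and "w' \<noteq> w \<Longrightarrow> a \<noteq> b \<Longrightarrow> \<bar>corr {i, j} (w', a) (w, b)\<bar> \<le> (1 / (real q - 1))\<^sup>2"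
proof -
  have row: "\<bar>corr {i, j} (w', a) (w, b)\<bar> \<le> \<bar>corr {i, j} (w', a) (w, a)\<bar> / (real q - 1)" if "a \<noteq> b"
    using abs_corr_row[OF w ab(1,2) that ab(3,4) ij q] .
  have col: "\<bar>corr {i, j} (w', a) (w, a)\<bar> \<le> 1 / (real q - 1)" if "w' \<noteq> w"
  proof -
    have "\<bar>corr {i, j} (w', a) (w, a)\<bar> = \<bar>corr {j, i} (prod.swap (a, w')) (prod.swap (a, w))\<bar>"
      by (simp add: insert_commute)
    also have "\<dots> = \<bar>corr {j, i} (a, w') (a, w)\<bar>"
      by (metis corr_swap corr_commute abs_minus_cancel)
    also have "\<dots> \<le> \<bar>corr {j, i} (a, w') (a, w')\<bar> / (real q - 1)"
      using abs_corr_row[OF ab(1,1,3,3) w(2,1) that w(4,3) ij[symmetric] q] .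
    also have "\<dots> \<le> 1 / (real q - 1)"
      using q abs_corr_le_1 by (intro divide_right_mono) auto
    finally show ?thesis .
  qed
  show "\<bar>corr {i, j} (w', a) (w, b)\<bar> \<le> 1 / (real q - 1)" if "(w', a) \<noteq> (w, b)"
  proof (cases "a = b")
    case True
    then show ?thesis using col that by auto
  next
    case False
    have "\<bar>corr {i, j} (w', a) (w, a)\<bar> / (real q - 1) \<le> 1 / (real q - 1)"
      using q abs_corr_le_1 by (intro divide_right_mono) auto
    then show ?thesis using row[OF False] by linarith
  qed
  show "\<bar>corr {i, j} (w', a) (w, b)\<bar> \<le> (1 / (real q - 1))\<^sup>2" if "w' \<noteq> w" "a \<noteq> b"
  proof -
    have "\<bar>corr {i, j} (w', a) (w, a)\<bar> / (real q - 1) \<le> 1 / (real q - 1) / (real q - 1)"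
      using q col[OF that(1)] by (intro divide_right_mono) auto
    then show ?thesis using row[OF that(2)] by (simp add: power2_eq_square)
  qed
qed

lemma pair_block_cases:
  assumes "z \<in> V \<times> V" "card (block z) = 2"
  obtains i j where "i \<noteq> j" "block z = {i, j}" "K (fst z) = {i}" "K (snd z) = {j}"
proof -
  have zV: "fst z \<in> V" "snd z \<in> V" using assms by auto
  obtain i where i: "K (fst z) = {i}"
    using K_cases[OF zV(1)] K_cases[OF zV(2)] assms(2) by (auto simp: block_def)
  obtain j where j: "K (snd z) = {j}"
    using K_cases[OF zV(2)] assms(2) i by (auto simp: block_def)
  have "i \<noteq> j" "block z = {i, j}" using assms(2) by (auto simp: block_def i j)
  then show thesis using that i j by blast
qed

lemma abs_corr_le:
  assumes z: "z \<in> V \<times> V" "z' \<in> V \<times> V" and blk: "block z' = block z" "card (block z) = 2"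
    and neq: "z' \<noteq> z" "z' \<noteq> prod.swap z" and q: "q > 1"
  shows "\<bar>corr (block z) z z'\<bar> \<le> 1 / (real q - 1)"
    and "ends z \<inter> ends z' = {} \<Longrightarrow> \<bar>corr (block z) z z'\<bar> \<le> (1 / (real q - 1))\<^sup>2"
proof -
  obtain i j where ij: "i \<noteq> j" "block z = {i, j}" "K (fst z) = {i}" "K (snd z) = {j}"
    using pair_block_cases[OF z(1) blk(2)] by blast
  obtain i' j' where ij': "i' \<noteq> j'" "block z' = {i', j'}" "K (fst z') = {i'}" "K (snd z') = {j'}"
    using pair_block_cases[OF z(2)] blk by metis
  \<comment> \<open>\<open>z'\<close> is turned so that its tail lies in the cluster of the tail of
    \<open>z\<close>; this affects only the sign of the correlation.\<close>
  define y where "y = (if i' = i then z' else prod.swap z')"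
  have "i' = i \<and> j' = j \<or> i' = j \<and> j' = i" using ij ij' blk by (auto simp: doubleton_eq_iff)
  then have y: "K (fst y) = {i}" "K (snd y) = {j}" "fst y \<in> V" "snd y \<in> V"
    using ij' z ij(1) by (auto simp: y_def)
  have zV: "fst z \<in> V" "snd z \<in> V" using z by auto
  have eq: "\<bar>corr (block z) z z'\<bar> = \<bar>corr {i, j} (fst z, snd z) (fst y, snd y)\<bar>"
    using ij(2) by (simp add: y_def corr_swap del: swap_simp)
  have "(fst z, snd z) \<noteq> (fst y, snd y)" using neq by (auto simp: y_def prod_eq_iff)
  then show "\<bar>corr (block z) z z'\<bar> \<le> 1 / (real q - 1)"
    unfolding eq using y ij zV q by (intro abs_corr_oriented(1))
  show "\<bar>corr (block z) z z'\<bar> \<le> (1 / (real q - 1))\<^sup>2" if "ends z \<inter> ends z' = {}"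
  proof -
    have "fst z \<noteq> fst y" "snd z \<noteq> snd y" using that by (auto simp: y_def ends_def split: if_splits)
    then show ?thesis unfolding eq using y ij zV q by (intro abs_corr_oriented(2))
  qed
qed

section \<open>Gluing independent blocks\<close>

definition glue :: "(nat set \<Rightarrow> 'a \<times> 'a \<Rightarrow> real) \<Rightarrow> 'a \<times> 'a \<Rightarrow> real" where
  "glue \<omega> z = (if z \<in> positions then \<omega> (block z) z else 0)"

lemma regular_sign_glue:
  assumes \<omega>: "\<omega> \<in> PiE blocks balanced"
  shows "regular_sign V (glue \<omega>)"
proof -
  have pos: "(v, u) \<in> positions \<longleftrightarrow> (u, v) \<in> positions" for u v by (auto simp: positions_def)
  have blk: "block (v, u) = block (u, v)" for u v by (auto simp: block_def)
  have \<omega>b: "\<omega> \<beta> \<in> balanced \<beta>" if "\<beta> \<in> blocks" for \<beta> using \<omega> that by auto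
  have bl: "block z \<in> blocks" if "z \<in> positions" for z using that by (simp add: blocks_def)
  show ?thesis unfolding regular_sign_def
  proof (intro conjI ballI impI allI)
    fix u v assume "u \<in> V" "v \<in> V" "u \<noteq> v"
    then have "(u, v) \<in> positions" by (simp add: positions_def)
    then show "glue \<omega> (u, v) \<in> {1, -1}"
      using balancedD(1)[OF \<omega>b[OF bl]] by (simp add: glue_def)
  next
    fix u v
    show "glue \<omega> (v, u) = - glue \<omega> (u, v)"
      using balancedD(3)[OF \<omega>b[OF bl], of "(u, v)" v u] by (simp add: glue_def pos[of v u] blk[of v u])
  next
    fix u assume u: "u \<in> V"
    have "(\<Sum>v\<in>V. glue \<omega> (u, v)) = (\<Sum>v\<in>V. \<Sum>\<beta>\<in>blocks. \<omega> \<beta> (u, v))"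
    proof (rule sum.cong[OF refl])
      fix v
      show "glue \<omega> (u, v) = (\<Sum>\<beta>\<in>blocks. \<omega> \<beta> (u, v))"
      proof (cases "(u, v) \<in> positions")
        case True
        have "(\<Sum>\<beta>\<in>blocks. \<omega> \<beta> (u, v)) = (\<Sum>\<beta>\<in>{block (u, v)}. \<omega> \<beta> (u, v))"
          using finite_blocks bl[OF True] balancedD(2)[OF \<omega>b, of _ "(u, v)"]
          by (intro sum.mono_neutral_right) auto
        then show ?thesis using True by (simp add: glue_def)
      next
        case False
        have "\<omega> \<beta> (u, v) = 0" if "\<beta> \<in> blocks" for \<beta> using balancedD(2)[OF \<omega>b[OF that]] False by blast
        then show ?thesis using False by (simp add: glue_def)
      qed
    qed
    also have "\<dots> = (\<Sum>\<beta>\<in>blocks. \<Sum>v\<in>V. \<omega> \<beta> (u, v))" by (rule sum.swap)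
    also have "\<dots> = 0" using balancedD(4)[OF \<omega>b] u by (intro sum.neutral) auto
    finally show "(\<Sum>v\<in>V. glue \<omega> (u, v)) = 0" .
  qed
qed

text \<open>This is the independence of the blocks: after regrouping the arcs by block, a sum over
  the product space of a product of blockwise factors splits.\<close>

lemma sum_blocks_prod:
  assumes S: "finite S" and z: "\<And>e. e \<in> S \<Longrightarrow> z e \<in> positions"
  shows "(\<Sum>\<omega>\<in>PiE blocks balanced. \<Prod>e\<in>S. h e (\<omega> (block (z e))))
    = (\<Prod>\<beta>\<in>blocks. \<Sum>d\<in>balanced \<beta>. \<Prod>e\<in>{e \<in> S. block (z e) = \<beta>}. h e d :: real)"
proof -
  have "(\<Prod>\<beta>\<in>blocks. \<Sum>d\<in>balanced \<beta>. \<Prod>e\<in>{e \<in> S. block (z e) = \<beta>}. h e d)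
    = (\<Sum>\<omega>\<in>PiE blocks balanced. \<Prod>\<beta>\<in>blocks. \<Prod>e\<in>{e \<in> S. block (z e) = \<beta>}. h e (\<omega> \<beta>))"
    by (intro prod_sum_PiE finite_blocks finite_balanced)
  also have "\<dots> = (\<Sum>\<omega>\<in>PiE blocks balanced. \<Prod>\<beta>\<in>blocks. \<Prod>e\<in>{e \<in> S. block (z e) = \<beta>}. h e (\<omega> (block (z e))))"
    by (intro sum.cong prod.cong) auto
  also have "\<dots> = (\<Sum>\<omega>\<in>PiE blocks balanced. \<Prod>e\<in>S. h e (\<omega> (block (z e))))"
    using S z finite_blocks by (intro sum.cong refl prod.group) (auto simp: blocks_def)
  finally show ?thesis by simp
qed

end

section \<open>The first moment estimate\<close>

locale balanced_clustering = clustered_orientation V K B q E k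
  for V :: "'a set" and K B q E k +
  assumes balanced_nonempty: "\<beta> \<in> blocks \<Longrightarrow> balanced \<beta> \<noteq> {}"
    and q_ge: "q \<ge> 3"
begin

abbreviation orientations :: "(nat set \<Rightarrow> 'a \<times> 'a \<Rightarrow> real) set" where
  "orientations \<equiv> PiE blocks balanced"

text \<open>The factor \<open>1 + d z\<close> is \<open>2\<close> for a preserved arc and
  \<open>0\<close> otherwise, which builds the normalization \<open>2 ^ e(H)\<close> into the
  average.\<close>

definition local_avg :: "('a \<Rightarrow> 'a) \<Rightarrow> nat set \<Rightarrow> real" where
  "local_avg p \<beta> = (\<Sum>d\<in>balanced \<beta>. \<Prod>e\<in>{e \<in> E. blk p e = \<beta>}. 1 + d (map_prod p p e)) / card (balanced \<beta>)"

definition global_avg :: "('a \<Rightarrow> 'a) \<Rightarrow> real" where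
  "global_avg p = (\<Sum>\<omega>\<in>orientations. \<Prod>e\<in>E. 1 + glue \<omega> (map_prod p p e)) / card orientations"

definition pair_corr :: "('a \<Rightarrow> 'a) \<Rightarrow> ('a \<times> 'a) \<times> ('a \<times> 'a) \<Rightarrow> real" where
  "pair_corr p z = corr (blk p (fst z)) (map_prod p p (fst z)) (map_prod p p (snd z))"

lemma arc_neq: "e \<in> E \<Longrightarrow> fst e \<noteq> snd e"
  using asym by (cases e) auto

lemma arc_positions:
  assumes p: "p permutes V" and e: "e \<in> E"
  shows "map_prod p p e \<in> positions"
proof -
  have "p (fst e) \<noteq> p (snd e)" using arc_neq[OF e] permutes_inj[OF p] by (simp add: inj_eq)
  moreover have "fst e \<in> V" "snd e \<in> V" using e E_subset by auto
  ultimately show ?thesis using permutes_in_image[OF p] by (simp add: positions_def mem_Times_iff)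
qed

lemma card_balanced_pos: "\<beta> \<in> blocks \<Longrightarrow> card (balanced \<beta>) > 0"
  using balanced_nonempty finite_balanced by (simp add: card_gt_0_iff)

lemma card_orientations: "card orientations = (\<Prod>\<beta>\<in>blocks. card (balanced \<beta>))"
  by (rule card_PiE[OF finite_blocks])

lemma card_orientations_pos: "card orientations > 0"
  unfolding card_orientations using card_balanced_pos by (intro prod_pos) auto

lemma finite_orientations: "finite orientations"
  using card_orientations_pos card_gt_0_iff by blast

text \<open>\<open>h\<close> stays general because two instances are used: \<open>1 + x\<close> over
  all arcs for \<open>global_avg\<close>, and the identity over two arcs for their joint
  mean.\<close>

lemma prod_avg:
  assumes p: "p permutes V" and S: "S \<subseteq> E"
  shows "(\<Sum>\<omega>\<in>orientations. \<Prod>e\<in>S. h (glue \<omega> (map_prod p p e))) / card orientations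
    = (\<Prod>\<beta>\<in>blocks. (\<Sum>d\<in>balanced \<beta>. \<Prod>e\<in>{e \<in> S. blk p e = \<beta>}. h (d (map_prod p p e))) / card (balanced \<beta>) :: real)"
proof -
  have fS: "finite S" using S finite_E finite_subset by blast
  have pos: "map_prod p p e \<in> positions" if "e \<in> S" for e using arc_positions[OF p] S that by blast
  have "(\<Sum>\<omega>\<in>orientations. \<Prod>e\<in>S. h (glue \<omega> (map_prod p p e)))
    = (\<Sum>\<omega>\<in>orientations. \<Prod>e\<in>S. h (\<omega> (blk p e) (map_prod p p e)))"
    using pos by (intro sum.cong prod.cong refl) (simp add: glue_def)
  also have "\<dots> = (\<Prod>\<beta>\<in>blocks. \<Sum>d\<in>balanced \<beta>. \<Prod>e\<in>{e \<in> S. blk p e = \<beta>}. h (d (map_prod p p e)))"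
    by (rule sum_blocks_prod[OF fS pos, where h = "\<lambda>e d. h (d (map_prod p p e))"])
  finally show ?thesis by (simp add: card_orientations prod_dividef)
qed

lemma global_avg_eq: "p permutes V \<Longrightarrow> global_avg p = (\<Prod>\<beta>\<in>blocks. local_avg p \<beta>)"
  unfolding global_avg_def local_avg_def by (rule prod_avg) auto

lemma global_avg_nonneg: "global_avg p \<ge> 0"
proof -
  have "0 \<le> 1 + glue \<omega> z" if \<omega>: "\<omega> \<in> orientations" for \<omega> z
  proof (cases "z \<in> positions")
    case True
    then have "\<omega> (block z) \<in> balanced (block z)" using \<omega> by (auto simp: blocks_def)
    from abs_balanced_le[OF this, of z] show ?thesis using True by (simp add: glue_def)
  qed (simp add: glue_def)
  then show ?thesis unfolding global_avg_def by (intro divide_nonneg_nonneg sum_nonneg prod_nonneg) auto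
qed

text \<open>Arcs in different blocks are independent with mean zero, which gives the indicator. The
  identity expresses block correlations by whole tournaments, to which regularity applies.\<close>

lemma pair_avg:
  assumes p: "p permutes V" and e: "e \<in> E" "e' \<in> E" "e \<noteq> e'"
  shows "(\<Sum>\<omega>\<in>orientations. glue \<omega> (map_prod p p e) * glue \<omega> (map_prod p p e')) / card orientations
    = of_bool (blk p e = blk p e') * pair_corr p (e, e')"
proof -
  let ?f = "\<lambda>\<beta>. (\<Sum>d\<in>balanced \<beta>. \<Prod>e\<in>{x \<in> {e, e'}. blk p x = \<beta>}. d (map_prod p p e)) / card (balanced \<beta>)"
  have bl: "blk p e \<in> blocks" using arc_positions[OF p e(1)] by (simp add: blocks_def)
  have "(\<Sum>\<omega>\<in>orientations. glue \<omega> (map_prod p p e) * glue \<omega> (map_prod p p e')) / card orientations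
    = (\<Sum>\<omega>\<in>orientations. \<Prod>x\<in>{e, e'}. glue \<omega> (map_prod p p x)) / card orientations"
    using e by simp
  also have "\<dots> = (\<Prod>\<beta>\<in>blocks. ?f \<beta>)"
    using e by (intro prod_avg[OF p, where h = "\<lambda>x. x"]) auto
  also have "\<dots> = ?f (blk p e) * (\<Prod>\<beta>\<in>blocks - {blk p e}. ?f \<beta>)"
    by (rule prod.remove[OF finite_blocks bl])
  also have "\<dots> = of_bool (blk p e = blk p e') * pair_corr p (e, e')"
  proof (cases "blk p e = blk p e'")
    case True
    have "\<forall>\<beta>\<in>blocks - {blk p e}. ?f \<beta> = 1"
    proof
      fix \<beta> assume \<beta>: "\<beta> \<in> blocks - {blk p e}"
      have empty: "{x \<in> {e, e'}. blk p x = \<beta>} = {}" using \<beta> True by blast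
      show "?f \<beta> = 1" unfolding empty using card_balanced_pos[of \<beta>] \<beta> by simp
    qed
    then have one: "(\<Prod>\<beta>\<in>blocks - {blk p e}. ?f \<beta>) = 1" by (rule prod.neutral)
    have eq: "{x \<in> {e, e'}. blk p x = blk p e} = {e, e'}" using True by blast
    have "?f (blk p e) = pair_corr p (e, e')"
      unfolding eq using e(3) by (simp add: pair_corr_def corr_def)
    then show ?thesis unfolding one using True by simp
  next
    case False
    have eq: "{x \<in> {e, e'}. blk p x = blk p e} = {e}" using False by blast
    have zero: "?f (blk p e) = 0" unfolding eq by (simp add: sum_balanced)
    show ?thesis unfolding zero using False by simp
  qed
  finally show ?thesis .
qed

lemma pair_corr_le:
  assumes p: "p permutes V" and z: "(e, e') \<in> same_pairs p" and two: "card (blk p e) = 2"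
  shows "\<bar>pair_corr p (e, e')\<bar> \<le> 1 / (real q - 1)"
    and "ends e \<inter> ends e' = {} \<Longrightarrow> \<bar>pair_corr p (e, e')\<bar> \<le> (1 / (real q - 1))\<^sup>2"
proof -
  have e: "e \<in> E" "e' \<in> E" "e \<noteq> e'" "blk p e' = blk p e" using z by (auto simp: same_pairs_def)
  have inj: "inj p" using permutes_inj[OF p] .
  have V: "map_prod p p e \<in> V \<times> V" "map_prod p p e' \<in> V \<times> V"
    using arc_positions[OF p] e by (auto simp: positions_def)
  have neq: "map_prod p p e' \<noteq> map_prod p p e"
    using e(3) inj by (cases e; cases e') (auto simp: inj_eq)
  have swap: "map_prod p p e' \<noteq> prod.swap (map_prod p p e)"
    using e(1,2) asym inj by (cases e; cases e') (auto simp: inj_eq)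
  show "\<bar>pair_corr p (e, e')\<bar> \<le> 1 / (real q - 1)"
    using abs_corr_le(1)[OF V e(4) two neq swap] q_ge by (simp add: pair_corr_def)
  have "ends (map_prod p p e) \<inter> ends (map_prod p p e') = {}" if "ends e \<inter> ends e' = {}"
    using that inj by (auto simp: ends_def inj_eq)
  then show "\<bar>pair_corr p (e, e')\<bar> \<le> (1 / (real q - 1))\<^sup>2" if "ends e \<inter> ends e' = {}"
    using abs_corr_le(2)[OF V e(4) two neq swap] q_ge that by (simp add: pair_corr_def)
qed

lemma internal_pairs_empty:
  assumes p: "p permutes V" and good: "internal_pairs p = {}" and z: "(e, e') \<in> same_pairs p"
  shows "card (blk p e) = 2"
proof -
  have "e \<in> E" using z by (auto simp: same_pairs_def)
  then have "card (blk p e) \<le> 2" using blk_bounds[OF p] E_subset by blast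
  moreover have "\<not> card (blk p e) \<le> 1" using good z unfolding internal_pairs_def by blast
  ultimately show ?thesis by linarith
qed

text \<open>Inside a pair block the arcs form a simple bipartite graph, and such a graph has no triangle:
  three arcs can be ordered such that the last one brings a new vertex.\<close>

lemma no_three_arcs:
  assumes p: "p permutes V" and good: "internal_pairs p = {}" "same_triples p = {}"
    and e: "e\<^sub>1 \<in> E" "e\<^sub>2 \<in> E" "e\<^sub>3 \<in> E" "e\<^sub>1 \<noteq> e\<^sub>2" "e\<^sub>1 \<noteq> e\<^sub>3" "e\<^sub>2 \<noteq> e\<^sub>3"
    and blk: "blk p e\<^sub>2 = blk p e\<^sub>1" "blk p e\<^sub>3 = blk p e\<^sub>1"
  shows False
proof -
  have sub: "ends x \<subseteq> ends y \<union> ends z"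
    if "x \<in> E" "y \<in> E" "z \<in> E" "y \<noteq> z" "blk p x = blk p y" "blk p z = blk p y" for x y z
  proof (rule ccontr)
    assume "\<not> ?thesis"
    then have "(y, z, x) \<in> same_triples p"
      using that unfolding same_triples_def same_pairs_def by simp
    then show False using good(2) by simp
  qed
  have two: "card (blk p e\<^sub>1) = 2"
    by (rule internal_pairs_empty[OF p good(1), of e\<^sub>1 e\<^sub>2]) (use e blk in \<open>auto simp: same_pairs_def\<close>)
  have V: "map_prod p p x \<in> V \<times> V" if "x \<in> E" for x
    using arc_positions[OF p that] by (auto simp: positions_def)
  obtain i j where ij: "i \<noteq> j" "blk p e\<^sub>1 = {i, j}"
    using pair_block_cases[OF V[OF e(1)] two] by metis
  have orient: "\<exists>a b. ends x = {a, b} \<and> K (p a) = {i} \<and> K (p b) = {j}" if x: "x \<in> E" "blk p x = blk p e\<^sub>1" for x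
  proof -
    obtain i' j' where ij': "i' \<noteq> j'" "blk p x = {i', j'}" "K (p (fst x)) = {i'}" "K (p (snd x)) = {j'}"
      using pair_block_cases[OF V[OF x(1)]] two x(2) by (metis fst_map_prod snd_map_prod)
    have "i' = i \<and> j' = j \<or> i' = j \<and> j' = i" using ij ij' x by (auto simp: doubleton_eq_iff)
    then show ?thesis using ij' unfolding ends_def by (metis insert_commute)
  qed
  obtain a\<^sub>1 b\<^sub>1 where ab1: "ends e\<^sub>1 = {a\<^sub>1, b\<^sub>1}" "K (p a\<^sub>1) = {i}" "K (p b\<^sub>1) = {j}" using orient[OF e(1) refl] by blast
  obtain a\<^sub>2 b\<^sub>2 where ab2: "ends e\<^sub>2 = {a\<^sub>2, b\<^sub>2}" "K (p a\<^sub>2) = {i}" "K (p b\<^sub>2) = {j}" using orient[OF e(2) blk(1)] by blast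
  obtain a\<^sub>3 b\<^sub>3 where ab3: "ends e\<^sub>3 = {a\<^sub>3, b\<^sub>3}" "K (p a\<^sub>3) = {i}" "K (p b\<^sub>3) = {j}" using orient[OF e(3) blk(2)] by blast
  have ab: "a \<noteq> b" if "K (p a) = {i}" "K (p b) = {j}" for a b using that ij(1) by auto
  have "{a\<^sub>1, b\<^sub>1} \<subseteq> {a\<^sub>2, b\<^sub>2} \<union> {a\<^sub>3, b\<^sub>3}" "{a\<^sub>2, b\<^sub>2} \<subseteq> {a\<^sub>1, b\<^sub>1} \<union> {a\<^sub>3, b\<^sub>3}"
    "{a\<^sub>3, b\<^sub>3} \<subseteq> {a\<^sub>1, b\<^sub>1} \<union> {a\<^sub>2, b\<^sub>2}"
    using sub[of e\<^sub>1 e\<^sub>2 e\<^sub>3] sub[of e\<^sub>2 e\<^sub>1 e\<^sub>3] sub[of e\<^sub>3 e\<^sub>1 e\<^sub>2] e blk ab1 ab2 ab3 by simp_all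
  then have "a\<^sub>1 \<in> {a\<^sub>2, a\<^sub>3}" "a\<^sub>2 \<in> {a\<^sub>1, a\<^sub>3}" "a\<^sub>3 \<in> {a\<^sub>1, a\<^sub>2}" "b\<^sub>1 \<in> {b\<^sub>2, b\<^sub>3}" "b\<^sub>2 \<in> {b\<^sub>1, b\<^sub>3}" "b\<^sub>3 \<in> {b\<^sub>1, b\<^sub>2}"
    using ab[OF ab1(2) ab1(3)] ab[OF ab1(2) ab2(3)] ab[OF ab1(2) ab3(3)]
      ab[OF ab2(2) ab1(3)] ab[OF ab2(2) ab2(3)] ab[OF ab2(2) ab3(3)]
      ab[OF ab3(2) ab1(3)] ab[OF ab3(2) ab2(3)] ab[OF ab3(2) ab3(3)] by auto
  \<comment> \<open>No value among the three \<open>a\<close>s occurs only once, so all three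
    coincide; likewise the \<open>b\<close>s.\<close>
  then have "a\<^sub>1 = a\<^sub>2 \<and> b\<^sub>1 = b\<^sub>2" by blast
  then have "ends e\<^sub>2 \<subseteq> ends e\<^sub>1" using ab1 ab2 by simp
  then show False using ends_subset_iff[OF e(1,2)] e(4) by simp
qed

text \<open>The exponential form turns the product over blocks into a sum. The assumption
  \<open>q \<ge> 3\<close> keeps the correlations within the range \<open>1/2\<close>.\<close>

lemma exp_le_one_plus:
  fixes s :: real
  assumes "\<bar>s\<bar> \<le> 1/2"
  shows "exp (s - 2 * s\<^sup>2) \<le> 1 + s"
proof -
  have "\<bar>ln (1 + s) - s\<bar> \<le> 2 * s\<^sup>2" using assms by (intro abs_ln_one_plus_x_minus_x_bound)
  then have "s - 2 * s\<^sup>2 \<le> ln (1 + s)" by linarith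
  then show ?thesis using assms by (subst ln_ge_iff[symmetric]) auto
qed

text \<open>A block with at most one arc averages to \<open>1\<close>, since entries have mean zero,
  and one with two arcs to \<open>1 + s\<close>. \<open>same_pairs\<close> lists each pair in both
  orders, hence the division by \<open>2\<close>.\<close>

lemma local_avg_ge:
  assumes p: "p permutes V" and good: "internal_pairs p = {}" "same_triples p = {}" and \<beta>: "\<beta> \<in> blocks"
  shows "exp (\<Sum>z\<in>{z \<in> same_pairs p. blk p (fst z) = \<beta>}. (pair_corr p z - 2 * (pair_corr p z)\<^sup>2) / 2) \<le> local_avg p \<beta>"
proof -
  let ?E = "{e \<in> E. blk p e = \<beta>}" and ?S = "{z \<in> same_pairs p. blk p (fst z) = \<beta>}"
  let ?N = "real (card (balanced \<beta>))"
  have N: "?N > 0" using card_balanced_pos[OF \<beta>] by simp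
  consider "?E = {}" | e where "?E = {e}" | e e' where "?E = {e, e'}" "e \<noteq> e'"
    | e e' e'' where "{e, e', e''} \<subseteq> ?E" "e \<noteq> e'" "e \<noteq> e''" "e' \<noteq> e''"
  proof -
    show thesis
    proof (cases "\<exists>e e' e''. {e, e', e''} \<subseteq> ?E \<and> e \<noteq> e' \<and> e \<noteq> e'' \<and> e' \<noteq> e''")
      case True
      then show thesis using that(4) by blast
    next
      case no_three: False
      show thesis
      proof (cases "\<exists>e e'. {e, e'} \<subseteq> ?E \<and> e \<noteq> e'")
        case True
        then obtain e e' where e: "{e, e'} \<subseteq> ?E" "e \<noteq> e'" by blast
        have "?E \<subseteq> {e, e'}" using no_three e by blast
        then show thesis using that(3)[of e e'] e by blast
      next
        case False
        then show thesis using that(1,2) by blast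
      qed
    qed
  qed
  then show ?thesis
  proof cases
    case 1
    have S: "?S = {}" using 1 unfolding same_pairs_def by auto
    show ?thesis unfolding local_avg_def 1 S using N by simp
  next
    case (2 e)
    have S: "?S = {}"
    proof (rule ccontr)
      assume "?S \<noteq> {}"
      then obtain x y where "x \<in> ?E" "y \<in> ?E" "x \<noteq> y" unfolding same_pairs_def by fastforce
      then show False unfolding 2 by simp
    qed
    have "local_avg p \<beta> = (\<Sum>d\<in>balanced \<beta>. 1 + d (map_prod p p e)) / ?N"
      unfolding local_avg_def 2 by simp
    also have "\<dots> = 1" using N by (simp add: sum.distrib sum_balanced)
    finally show ?thesis unfolding S by simp
  next
    case (3 e e')
    have e: "e \<in> E" "e' \<in> E" "blk p e = \<beta>" "blk p e' = \<beta>" using 3 by auto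
    have S: "?S = {(e, e'), (e', e)}"
    proof
      show "?S \<subseteq> {(e, e'), (e', e)}"
      proof
        fix z assume "z \<in> ?S"
        then have "fst z \<in> ?E" "snd z \<in> ?E" "fst z \<noteq> snd z" unfolding same_pairs_def by auto
        then show "z \<in> {(e, e'), (e', e)}" unfolding 3(1) by (cases z) auto
      qed
      show "{(e, e'), (e', e)} \<subseteq> ?S" using e 3(2) unfolding same_pairs_def by auto
    qed
    define s where "s = pair_corr p (e, e')"
    have s': "pair_corr p (e', e) = s" unfolding s_def pair_corr_def using e by (simp add: corr_commute)
    have sp: "(e, e') \<in> same_pairs p" using S by auto
    have "\<bar>s\<bar> \<le> 1 / (real q - 1)"
      unfolding s_def by (rule pair_corr_le(1)[OF p sp internal_pairs_empty[OF p good(1) sp]])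
    also have "\<dots> \<le> 1 / 2" using q_ge by (simp add: field_simps)
    finally have s: "\<bar>s\<bar> \<le> 1/2" .
    have "local_avg p \<beta> = (\<Sum>d\<in>balanced \<beta>. (1 + d (map_prod p p e)) * (1 + d (map_prod p p e'))) / ?N"
      unfolding local_avg_def 3(1) using 3(2) by simp
    also have "(\<Sum>d\<in>balanced \<beta>. (1 + d (map_prod p p e)) * (1 + d (map_prod p p e')))
       = ?N + (\<Sum>d\<in>balanced \<beta>. d (map_prod p p e) * d (map_prod p p e'))"
      by (simp add: distrib_left distrib_right sum.distrib sum_balanced)
    also have "\<dots> / ?N = 1 + s" using N e by (simp add: s_def pair_corr_def corr_def add_divide_distrib)
    finally have "local_avg p \<beta> = 1 + s" .
    moreover have "(\<Sum>z\<in>?S. (pair_corr p z - 2 * (pair_corr p z)\<^sup>2) / 2) = s - 2 * s\<^sup>2"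
      unfolding S using 3(2) by (simp add: s' s_def[symmetric])
    ultimately show ?thesis using exp_le_one_plus[OF s] by simp
  next
    case (4 e e' e'')
    then show ?thesis using no_three_arcs[OF p good, of e e' e''] by auto
  qed
qed

text \<open>The weights are the squares of the two correlation bounds. The \<open>2\<close> in
  \<open>2 * s\<^sup>2\<close> cancels against the double counting of ordered pairs.\<close>

definition loss :: "('a \<Rightarrow> 'a) \<Rightarrow> real" where
  "loss p = (1 / (real q - 1))\<^sup>2 * card (adjacent_same_pairs p) + (1 / (real q - 1))^4 * card (disjoint_same_pairs p)"

lemma loss_nonneg: "loss p \<ge> 0"
  unfolding loss_def by (intro add_nonneg_nonneg mult_nonneg_nonneg) auto

lemma sum_pair_corr_square_le:
  assumes p: "p permutes V" and good: "internal_pairs p = {}"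
  shows "(\<Sum>z\<in>same_pairs p. (pair_corr p z)\<^sup>2) \<le> loss p"
proof -
  let ?A = "adjacent_same_pairs p" and ?D = "disjoint_same_pairs p"
  have eq: "same_pairs p = ?A \<union> ?D" "?A \<inter> ?D = {}"
    unfolding adjacent_same_pairs_def disjoint_same_pairs_def by auto
  have fin: "finite ?A" "finite ?D" using finite_same_pairs[of p] unfolding eq(1) by auto
  have "(\<Sum>z\<in>same_pairs p. (pair_corr p z)\<^sup>2) = (\<Sum>z\<in>?A. (pair_corr p z)\<^sup>2) + (\<Sum>z\<in>?D. (pair_corr p z)\<^sup>2)"
    unfolding eq(1) by (rule sum.union_disjoint[OF fin eq(2)])
  also have "\<dots> \<le> (\<Sum>z\<in>?A. (1 / (real q - 1))\<^sup>2) + (\<Sum>z\<in>?D. ((1 / (real q - 1))\<^sup>2)\<^sup>2)"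
  proof (intro add_mono sum_mono)
    fix z assume "z \<in> ?A"
    then have z: "(fst z, snd z) \<in> same_pairs p" by (auto simp: adjacent_same_pairs_def)
    from pair_corr_le(1)[OF p z internal_pairs_empty[OF p good z]]
    have "\<bar>pair_corr p z\<bar> \<le> 1 / (real q - 1)" by simp
    from power_mono[OF this abs_ge_zero, of 2]
    show "(pair_corr p z)\<^sup>2 \<le> (1 / (real q - 1))\<^sup>2" by simp
  next
    fix z assume "z \<in> ?D"
    then have z: "(fst z, snd z) \<in> same_pairs p" "ends (fst z) \<inter> ends (snd z) = {}"
      by (auto simp: disjoint_same_pairs_def)
    from pair_corr_le(2)[OF p z(1) internal_pairs_empty[OF p good z(1)] z(2)]
    have "\<bar>pair_corr p z\<bar> \<le> (1 / (real q - 1))\<^sup>2" by simp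
    from power_mono[OF this abs_ge_zero, of 2]
    show "(pair_corr p z)\<^sup>2 \<le> ((1 / (real q - 1))\<^sup>2)\<^sup>2" by simp
  qed
  also have "\<dots> = loss p" unfolding loss_def by (simp add: power_mult[symmetric])
  finally show ?thesis .
qed

lemma global_avg_ge_good:
  assumes p: "p permutes V" and good: "internal_pairs p = {}" "same_triples p = {}"
  shows "global_avg p \<ge> 1 + (\<Sum>z\<in>same_pairs p. pair_corr p z) / 2 - loss p"
proof -
  let ?g = "\<lambda>z. (pair_corr p z - 2 * (pair_corr p z)\<^sup>2) / 2"
  have "1 + (\<Sum>z\<in>same_pairs p. pair_corr p z) / 2 - loss p
    \<le> 1 + (\<Sum>z\<in>same_pairs p. pair_corr p z) / 2 - (\<Sum>z\<in>same_pairs p. (pair_corr p z)\<^sup>2)"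
    using sum_pair_corr_square_le[OF p good(1)] by simp
  also have "\<dots> = 1 + (\<Sum>z\<in>same_pairs p. ?g z)"
    by (simp add: diff_divide_distrib sum_subtractf sum_divide_distrib)
  also have "\<dots> \<le> exp (\<Sum>z\<in>same_pairs p. ?g z)" by (rule exp_ge_add_one_self)
  also have "(\<Sum>z\<in>same_pairs p. ?g z) = (\<Sum>\<beta>\<in>blocks. \<Sum>z\<in>{z \<in> same_pairs p. blk p (fst z) = \<beta>}. ?g z)"
    using arc_positions[OF p]
    by (intro sum.group[symmetric] finite_same_pairs finite_blocks) (auto simp: same_pairs_def blocks_def)
  also have "exp \<dots> = (\<Prod>\<beta>\<in>blocks. exp (\<Sum>z\<in>{z \<in> same_pairs p. blk p (fst z) = \<beta>}. ?g z))"
    using finite_blocks by (rule exp_sum)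
  also have "\<dots> \<le> (\<Prod>\<beta>\<in>blocks. local_avg p \<beta>)"
    by (intro prod_mono conjI local_avg_ge p good) auto
  also have "\<dots> = global_avg p" using global_avg_eq[OF p] by simp
  finally show ?thesis .
qed

text \<open>On a bad \<open>p\<close> the correction is at least
  \<open>1 + card (same_pairs p)\<close>. As correlations do not exceed \<open>1\<close>, the right
  side is then at most zero, and nonnegativity of \<open>global_avg\<close> suffices.\<close>

lemma global_avg_ge:
  assumes p: "p permutes V"
  shows "global_avg p \<ge> 1 + (\<Sum>z\<in>same_pairs p. pair_corr p z) / 2 - loss p
    - bad_count p * (1 + real (card (same_pairs p)))"
proof (cases "internal_pairs p = {} \<and> same_triples p = {}")
  case True
  then show ?thesis using global_avg_ge_good[OF p] by (simp add: bad_count_def)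
next
  case False
  have "finite (internal_pairs p)"
    by (rule finite_subset[OF _ finite_same_pairs[of p]]) (auto simp: internal_pairs_def)
  moreover have "finite (same_triples p)"
    by (rule finite_subset[of _ "E \<times> E \<times> E"]) (auto simp: same_triples_def finite_E)
  ultimately have "card (internal_pairs p) + card (same_triples p) \<ge> 1"
    using False by (auto simp: Suc_le_eq card_gt_0_iff)
  then have "1 \<le> bad_count p" unfolding bad_count_def by linarith
  then have "1 * (1 + real (card (same_pairs p))) \<le> bad_count p * (1 + real (card (same_pairs p)))"
    by (intro mult_right_mono) auto
  moreover have "(\<Sum>z\<in>same_pairs p. pair_corr p z) \<le> real (card (same_pairs p))"
    using sum_mono[of "same_pairs p" "pair_corr p" "\<lambda>_. 1"] abs_corr_le_1
    unfolding pair_corr_def by (simp add: abs_le_iff)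
  moreover have "0 \<le> real (card (same_pairs p))" by simp
  moreover have "1 + R / 2 - L - X \<le> G"
    if "1 * (1 + W) \<le> X" "R \<le> W" "0 \<le> W" "0 \<le> L" "0 \<le> G" for R L X W G :: real
  proof -
    have "R / 2 \<le> W" using that(2,3) by (simp add: field_simps)
    then show ?thesis using that by simp
  qed
  ultimately show ?thesis using loss_nonneg[of p] global_avg_nonneg[of p] by blast
qed

text \<open>This is \<open>plus(H) - minus(H)\<close> in the form produced by
  \<open>sum_permutes_two_arcs\<close>; \<open>surplus_eq\<close> proves the equality.\<close>

definition surplus :: real where
  "surplus = (\<Sum>(e, e')\<in>{(e, e') \<in> E \<times> E. e \<noteq> e'}.
     of_bool (snd e = fst e') + of_bool (fst e = snd e') - of_bool (fst e = fst e') - of_bool (snd e = snd e')) / 2"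

text \<open>The averages are exchanged: each glued orientation is a regular sign matrix, for which
  the sum over \<open>p\<close> is known and does not depend on the orientation.\<close>

lemma sum_pair_corr:
  "(\<Sum>p | p permutes V. (\<Sum>z\<in>same_pairs p. pair_corr p z) / 2) = fact (card V) / (n - 2) * surplus"
proof -
  let ?P = "{(e, e') \<in> E \<times> E. e \<noteq> e'}"
  let ?s = "\<lambda>(e, e'). of_bool (snd e = fst e') + of_bool (fst e = snd e') - of_bool (fst e = fst e') - of_bool (snd e = snd e') :: real"
  let ?c = "fact (card V) / (n - 2)"
  let ?x = "\<lambda>\<omega> p z. glue \<omega> (map_prod p p (fst z)) * glue \<omega> (map_prod p p (snd z))"
  let ?N = "real (card orientations)"
  have N: "?N > 0" using card_orientations_pos by simp
  have fP: "finite ?P" by (rule finite_subset[of _ "E \<times> E"]) (use finite_E in auto)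
  have "(\<Sum>p | p permutes V. \<Sum>z\<in>same_pairs p. pair_corr p z)
     = (\<Sum>p | p permutes V. \<Sum>z\<in>?P. (\<Sum>\<omega>\<in>orientations. ?x \<omega> p z) / ?N)"
  proof (rule sum.cong[OF refl])
    fix p assume "p \<in> {p. p permutes V}"
    then have p: "p permutes V" by simp
    have "(\<Sum>z\<in>same_pairs p. pair_corr p z) = (\<Sum>z\<in>?P. of_bool (blk p (fst z) = blk p (snd z)) * pair_corr p z)"
      by (rule sum.mono_neutral_cong_left[OF fP]) (auto simp: same_pairs_def)
    also have "\<dots> = (\<Sum>z\<in>?P. (\<Sum>\<omega>\<in>orientations. ?x \<omega> p z) / ?N)"
    proof (rule sum.cong[OF refl])
      fix z assume "z \<in> ?P"
      then have "fst z \<in> E" "snd z \<in> E" "fst z \<noteq> snd z" by auto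
      from pair_avg[OF p this]
      show "of_bool (blk p (fst z) = blk p (snd z)) * pair_corr p z = (\<Sum>\<omega>\<in>orientations. ?x \<omega> p z) / ?N"
        by simp
    qed
    finally show "(\<Sum>z\<in>same_pairs p. pair_corr p z) = \<dots>" .
  qed
  also have "\<dots> = (\<Sum>z\<in>?P. (\<Sum>\<omega>\<in>orientations. \<Sum>p | p permutes V. ?x \<omega> p z) / ?N)"
    by (subst sum.swap, simp only: sum_divide_distrib[symmetric])
      (intro sum.cong[OF refl] arg_cong[of _ _ "\<lambda>x. x / ?N"] sum.swap)
  also have "\<dots> = (\<Sum>z\<in>?P. (\<Sum>\<omega>\<in>orientations. ?c * ?s z) / ?N)"
  proof (intro sum.cong[OF refl] arg_cong[of _ _ "\<lambda>x. x / ?N"])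
    fix z \<omega> assume z: "z \<in> ?P" and \<omega>: "\<omega> \<in> orientations"
    obtain a b c d where z_eq: "z = ((a, b), (c, d))" by (cases z) auto
    have abcd: "(a, b) \<in> E" "(c, d) \<in> E" "(a, b) \<noteq> (c, d)" using z by (auto simp: z_eq)
    then have "(a, b) \<noteq> (d, c)" "a \<noteq> b" "c \<noteq> d" using asym by auto
    then have "(\<Sum>p | p permutes V. glue \<omega> (p a, p b) * glue \<omega> (p c, p d)) =
      ?c * (of_bool (b = c) + of_bool (a = d) - of_bool (a = c) - of_bool (b = d))"
      using abcd E_subset n_ge by (intro sum_permutes_two_arcs regular_sign_glue \<omega> finite_V) auto
    then show "(\<Sum>p | p permutes V. ?x \<omega> p z) = ?c * ?s z" by (simp add: z_eq)
  qed
  also have "\<dots> = (\<Sum>z\<in>?P. ?c * ?s z)" using N by simp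
  also have "\<dots> = ?c * (\<Sum>z\<in>?P. ?s z)" by (simp only: sum_distrib_left)
  also have "(\<Sum>z\<in>?P. ?s z) = 2 * surplus" by (simp add: surplus_def)
  finally have eq: "(\<Sum>p | p permutes V. \<Sum>z\<in>same_pairs p. pair_corr p z) = ?c * (2 * surplus)" .
  have half: "c * (2 * s) / 2 = c * s" for c s :: real by simp
  show ?thesis unfolding sum_divide_distrib[symmetric] eq half ..
qed

lemma sum_loss_le:
  assumes "real B \<le> 8 * (real q - 1)"
  shows "(\<Sum>p | p permutes V. loss p) \<le> 288 * k\<^sup>2 / (real q - 1) * fact (card V)"
proof -
  define t where "t = 1 / (real q - 1)"
  have t: "t > 0" "t \<le> 1" "B * t \<le> 8" using q_ge assms by (auto simp: t_def field_simps)
  have "(\<Sum>p | p permutes V. loss p) = t\<^sup>2 * (\<Sum>p | p permutes V. real (card (adjacent_same_pairs p)))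
     + t^4 * (\<Sum>p | p permutes V. real (card (disjoint_same_pairs p)))"
    unfolding loss_def t_def[symmetric] by (simp add: sum.distrib sum_distrib_left)
  also have "\<dots> \<le> t\<^sup>2 * (4 * k\<^sup>2 * B * fact (card V)) + t^4 * (4 * k\<^sup>2 * B\<^sup>2 * fact (card V))"
    by (intro add_mono mult_left_mono sum_adjacent_same_pairs_le sum_disjoint_same_pairs_le) auto
  \<comment> \<open>One factor \<open>t\<close> is split off; \<open>B * t \<le> 8\<close> bounds
    the bracket by \<open>8 + 64 = 72\<close>, and \<open>4 * 72 = 288\<close>.\<close>
  also have "\<dots> = 4 * k\<^sup>2 * fact (card V) * t * (B * t + t * (B * t)\<^sup>2)"
    by (simp add: algebra_simps power2_eq_square power4_eq_xxxx)
  also have "\<dots> \<le> 4 * k\<^sup>2 * fact (card V) * t * (8 + 1 * 8\<^sup>2)"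
    using t by (intro mult_left_mono add_mono mult_mono power_mono) auto
  finally show ?thesis by (simp add: t_def field_simps)
qed

lemma sum_global_avg_ge:
  assumes B: "real B \<le> 8 * (real q - 1)"
  shows "(\<Sum>p | p permutes V. global_avg p) \<ge> fact (card V) *
    (1 + surplus / (n - 2) - 288 * k\<^sup>2 / (real q - 1)
      - (1 + 36 * k\<^sup>2 + 2 * k * C) * (4 * k * B * C + k * C\<^sup>2) / n)"
proof -
  have "(\<Sum>p | p permutes V. global_avg p) \<ge> (\<Sum>p | p permutes V. 1 + (\<Sum>z\<in>same_pairs p. pair_corr p z) / 2 - loss p
    - bad_count p * (1 + real (card (same_pairs p))))"
    by (intro sum_mono global_avg_ge) simp
  also have "(\<Sum>p | p permutes V. 1 + (\<Sum>z\<in>same_pairs p. pair_corr p z) / 2 - loss p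
    - bad_count p * (1 + real (card (same_pairs p)))) =
      fact (card V) + fact (card V) / (n - 2) * surplus - (\<Sum>p | p permutes V. loss p)
      - ((\<Sum>p | p permutes V. bad_count p) + (\<Sum>p | p permutes V. bad_count p * real (card (same_pairs p))))"
    by (simp only: sum_subtractf sum.distrib sum_pair_corr sum_one_permutes distrib_left mult_1_right)
  finally have "(\<Sum>p | p permutes V. global_avg p) \<ge> fact (card V) + fact (card V) / (n - 2) * surplus - (\<Sum>p | p permutes V. loss p)
      - ((\<Sum>p | p permutes V. bad_count p) + (\<Sum>p | p permutes V. bad_count p * real (card (same_pairs p))))" .
  moreover have "(\<Sum>p | p permutes V. bad_count p) + (\<Sum>p | p permutes V. bad_count p * real (card (same_pairs p)))
    \<le> (1 + 36 * k\<^sup>2 + 2 * k * C) * (4 * k * B * C + k * C\<^sup>2) / n * fact (card V)"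
  proof -
    have "(1 + 36 * k\<^sup>2 + 2 * k * C) * (\<Sum>p | p permutes V. bad_count p)
      \<le> (1 + 36 * k\<^sup>2 + 2 * k * C) * ((4 * k * B * C + k * C\<^sup>2) / n * fact (card V))"
      using C_nonneg by (intro mult_left_mono sum_bad_count_le) auto
    then show ?thesis using sum_bad_count_same_pairs_le by (simp add: algebra_simps)
  qed
  ultimately show ?thesis using sum_loss_le[OF B] by (simp add: algebra_simps)
qed

lemma ex_orientation_ge:
  assumes "(\<Sum>p | p permutes V. global_avg p) \<ge> c"
  shows "\<exists>x. regular_sign V x \<and> (\<Sum>p | p permutes V. \<Prod>e\<in>E. 1 + x (map_prod p p e)) \<ge> c"
proof (rule ccontr)
  assume *: "\<not> ?thesis"
  let ?N = "real (card orientations)"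
  have N: "?N > 0" using card_orientations_pos by simp
  have "(\<Sum>p | p permutes V. global_avg p)
     = (\<Sum>\<omega>\<in>orientations. \<Sum>p | p permutes V. \<Prod>e\<in>E. 1 + glue \<omega> (map_prod p p e)) / ?N"
    unfolding global_avg_def sum_divide_distrib[symmetric] by (intro arg_cong[of _ _ "\<lambda>x. x / ?N"] sum.swap)
  also have "\<dots> < (\<Sum>\<omega>\<in>orientations. c) / ?N"
    using N * regular_sign_glue finite_orientations
    by (intro divide_strict_right_mono sum_strict_mono) (force simp: not_le)+
  also have "\<dots> = c" using N by simp
  finally show False using assms by simp
qed

end

section \<open>Existence of clusters with balanced blocks\<close>

text \<open>The tournament on \<open>{..<n}\<close> with \<open>i \<rightarrow> j\<close> for \<open>i < j\<close> iff \<open>i + j\<close> is even is balanced on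
  all blocks at once, when the clusters are intervals of even length starting at odd places and
  \<open>0\<close> is left out.\<close>

definition alt_sign :: "nat \<Rightarrow> nat \<Rightarrow> real" where
  "alt_sign i j = (if i < j then 1 else if j < i then -1 else 0) * (-1) ^ (i + j)"

lemma sum_alternating:
  assumes "odd l" "l \<le> u"
  shows "(\<Sum>j\<in>{l..<u}. (-1 :: real) ^ j) = (if odd u then 0 else -1)"
  using assms(2)
proof (induction u rule: dec_induct)
  case base
  then show ?case using assms(1) by simp
next
  case (step m)
  then show ?case by (simp add: sum.atLeastLessThan_Suc)
qed

lemma sum_alt_sign_interval:
  assumes "odd l" "odd u" "l \<le> u" "i < l \<or> u \<le> i"
  shows "(\<Sum>j\<in>{l..<u}. alt_sign i j) = 0"
proof -
  define s :: real where "s = (if i < l then 1 else -1)"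
  have "(\<Sum>j\<in>{l..<u}. alt_sign i j) = (\<Sum>j\<in>{l..<u}. s * (-1) ^ i * (-1) ^ j)"
    using assms(4) by (intro sum.cong refl) (auto simp: alt_sign_def s_def power_add)
  also have "\<dots> = s * (-1) ^ i * (\<Sum>j\<in>{l..<u}. (-1) ^ j)" by (simp only: sum_distrib_left)
  also have "\<dots> = 0" using sum_alternating[of l u] assms by simp
  finally show ?thesis .
qed

text \<open>Seen from outside, a cluster alternates over an even number of places and cancels.
  Within its own cluster, row \<open>i\<close> has an odd number of nonzero entries and sums to
  \<open>(-1)^i\<close>; the entry at the leftover vertex \<open>0\<close> is \<open>-(-1)^i\<close>
  and repairs this. Hence the leftover vertex belongs to every internal block.\<close>

lemma sum_alt_sign_block:
  fixes c :: "nat \<Rightarrow> nat"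
  assumes c: "\<And>b. {j \<in> {1..<n}. c j = b} = {} \<or>
      (\<exists>l u. odd l \<and> odd u \<and> l \<le> u \<and> {j \<in> {1..<n}. c j = b} = {l..<u})"
    and K: "\<And>j. K j = (if j = 0 then {} else {c j})" and i: "i < n"
  shows "(\<Sum>j | j < n \<and> j \<noteq> i \<and> K i \<union> K j = \<beta>. alt_sign i j) = 0"
proof -
  let ?J = "{j. j < n \<and> j \<noteq> i \<and> K i \<union> K j = \<beta>}"
  define I where "I b = {j \<in> {1..<n}. c j = b}" for b
  have I_iff: "j \<in> I b \<longleftrightarrow> 0 < j \<and> j < n \<and> c j = b" for j b unfolding I_def by auto
  have cI: "I b = {} \<or> (\<exists>l u. odd l \<and> odd u \<and> l \<le> u \<and> I b = {l..<u})" for b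
    using c[of b] unfolding I_def .
  have whole: "(\<Sum>j\<in>I b. alt_sign i j) = 0" if b: "i \<notin> I b" for b
  proof (cases "I b = {}")
    case False
    then obtain l u where lu: "odd l" "odd u" "l \<le> u" "I b = {l..<u}" using cI by blast
    have "i < l \<or> u \<le> i" using b unfolding lu(4) by auto
    then show ?thesis unfolding lu(4) by (rule sum_alt_sign_interval[OF lu(1-3)])
  qed simp
  show ?thesis
  proof (cases "i = 0")
    case True
    show ?thesis
    proof (cases "\<exists>b. \<beta> = {b}")
      case ex: True
      then obtain b where "\<beta> = {b}" by blast
      then have J: "?J = I b" using True by (auto simp: K I_iff)
      show ?thesis unfolding J by (rule whole) (simp add: True I_iff)
    next
      case False
      then have J: "?J = {}" using True by (auto simp: K)
      show ?thesis unfolding J by simp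
    qed
  next
    case i0: False
    have iI: "i \<in> I (c i)" using i0 i by (simp add: I_iff)
    consider "\<beta> = {c i}" | b where "b \<noteq> c i" "\<beta> = {c i, b}" | "\<beta> \<noteq> {c i}" "\<And>b. \<beta> \<noteq> {c i, b}"
      by blast
    then show ?thesis
    proof cases
      case 1
      obtain l u where lu: "odd l" "odd u" "l \<le> u" "I (c i) = {l..<u}" using cI iI by blast
      have liu: "l \<le> i" "i < u" "1 \<le> l" using iI odd_pos[OF lu(1)] unfolding lu(4) by auto
      have "?J = insert 0 (I (c i) - {i})" using 1 i0 i by (auto simp: K I_iff)
      moreover have "{l..<u} - {i} = {l..<i} \<union> {Suc i..<u}" using liu by auto
      ultimately have J: "?J = insert 0 ({l..<i} \<union> {Suc i..<u})" by (simp only: lu(4))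
      have "(\<Sum>j\<in>?J. alt_sign i j) = alt_sign i 0 + ((\<Sum>j\<in>{l..<i}. alt_sign i j) + (\<Sum>j\<in>{Suc i..<u}. alt_sign i j))"
        unfolding J using liu by (subst sum.insert) (auto intro!: sum.union_disjoint)
      also have "(\<Sum>j\<in>{l..<i}. alt_sign i j) = - ((-1) ^ i * (\<Sum>j\<in>{l..<i}. (-1) ^ j))"
        by (simp add: alt_sign_def power_add sum_distrib_left sum_negf)
      also have "(\<Sum>j\<in>{Suc i..<u}. alt_sign i j) = (-1) ^ i * (\<Sum>j\<in>{Suc i..<u}. (-1) ^ j)"
        by (simp add: alt_sign_def power_add sum_distrib_left)
      \<comment> \<open>The alternating sum over the whole cluster is zero, so the part right of
        \<open>i\<close> is expressed by the part left of \<open>i\<close>, whose value depends only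
        on the parity of \<open>i\<close>.\<close>
      also have "(\<Sum>j\<in>{Suc i..<u}. (-1 :: real) ^ j) = - ((-1) ^ i) - (\<Sum>j\<in>{l..<i}. (-1) ^ j)"
      proof -
        have "(\<Sum>j\<in>{l..<u}. (-1 :: real) ^ j) = (\<Sum>j\<in>{l..<i}. (-1) ^ j) + (\<Sum>j\<in>{i..<u}. (-1) ^ j)"
          using liu by (intro sum.atLeastLessThan_concat[symmetric]) auto
        moreover have "(\<Sum>j\<in>{i..<u}. (-1 :: real) ^ j) = (-1) ^ i + (\<Sum>j\<in>{Suc i..<u}. (-1) ^ j)"
          using liu by (simp add: sum.atLeast_Suc_lessThan)
        moreover have "(\<Sum>j\<in>{l..<u}. (-1 :: real) ^ j) = 0" using sum_alternating[OF lu(1,3)] lu(2) by simp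
        ultimately show ?thesis by linarith
      qed
      also have "alt_sign i 0 = - ((-1) ^ i)" using i0 by (simp add: alt_sign_def)
      finally show ?thesis using sum_alternating[OF lu(1) liu(1)] by (cases "odd i") simp_all
    next
      case (2 b)
      then have J: "?J = I b" using i0 by (auto simp: K I_iff doubleton_eq_iff)
      show ?thesis unfolding J by (rule whole) (use 2(1) in \<open>simp add: I_iff\<close>)
    next
      case 3
      then have J: "?J = {}" using i0 by (auto simp: K)
      show ?thesis unfolding J by simp
    qed
  qed
qed

lemma ex_interval_clusters:
  assumes n: "odd n" "q < n" and q: "even q" "q > 0"
  shows "\<exists>c :: nat \<Rightarrow> nat. \<forall>b. {j \<in> {1..<n}. c j = b} = {} \<or>
    (\<exists>l u. odd l \<and> odd u \<and> l + q \<le> u \<and> u \<le> l + 2 * q \<and> {j \<in> {1..<n}. c j = b} = {l..<u})"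
proof -
  define M where "M = (n - 1) div q"
  \<comment> \<open>Runs of length \<open>q\<close> starting at place \<open>1\<close>; the
    \<open>min\<close> lets the last run absorb the remainder, so its length stays below
    \<open>2 * q\<close>. As \<open>q\<close> is even and \<open>n\<close> odd, all interval bounds
    are odd.\<close>
  define c where "c j = min ((j - 1) div q) (M - 1)" for j
  have M: "M > 0" using n q unfolding M_def by (simp add: div_greater_zero_iff)
  have Mq: "M * q \<le> n - 1" "n - 1 < M * q + q"
    using q unfolding M_def by (simp_all add: dividend_less_div_times add.commute)
  have M1: "M * q = (M - 1) * q + q" using M by (cases M) auto
  have "{j \<in> {1..<n}. c j = b} = {} \<or>
    (\<exists>l u. odd l \<and> odd u \<and> l + q \<le> u \<and> u \<le> l + 2 * q \<and> {j \<in> {1..<n}. c j = b} = {l..<u})" for b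
  proof -
    consider "b < M - 1" | "b = M - 1" | "b > M - 1" by linarith
    then show ?thesis
    proof cases
      case 1
      have "(b + 1) * q \<le> (M - 1) * q" using 1 by (intro mult_le_mono1) auto
      then have bound: "b * q + q + q \<le> n - 1" using Mq M1 by simp
      have iff: "c j = b \<longleftrightarrow> b * q \<le> j - 1 \<and> j - 1 < b * q + q" for j
      proof -
        have "c j = b \<longleftrightarrow> (j - 1) div q = b" using 1 unfolding c_def by auto
        also have "\<dots> \<longleftrightarrow> b * q \<le> j - 1 \<and> j - 1 < b * q + q"
          using div_times_less_eq_dividend[of "j - 1" q] dividend_less_div_times[OF q(2), of "j - 1"]
            div_nat_eqI[of q b "j - 1"] by (auto simp: mult.commute add.commute)
        finally show ?thesis .
      qed
      have "{j \<in> {1..<n}. c j = b} = {b * q + 1..<b * q + 1 + q}"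
        unfolding iff using bound by auto
      moreover have "odd (b * q + 1)" "odd (b * q + 1 + q)" "b * q + 1 + q \<le> b * q + 1 + q"
        "b * q + 1 + q \<le> b * q + 1 + 2 * q" using q by auto
      ultimately show ?thesis by metis
    next
      case 2
      have iff: "c j = b \<longleftrightarrow> b * q \<le> j - 1" for j
      proof -
        have "c j = b \<longleftrightarrow> b \<le> (j - 1) div q" using 2 unfolding c_def by auto
        also have "\<dots> \<longleftrightarrow> b * q \<le> j - 1" using q by (simp add: less_eq_div_iff_mult_less_eq)
        finally show ?thesis .
      qed
      have "{j \<in> {1..<n}. c j = b} = {b * q + 1..<n}" unfolding iff by auto
      moreover have "b * q + 1 + q \<le> n" "n \<le> b * q + 1 + 2 * q" using 2 M1 Mq n by auto
      moreover have "odd (b * q + 1)" using q by simp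
      ultimately show ?thesis using n(1) by metis
    next
      case 3
      then show ?thesis unfolding c_def by auto
    qed
  qed
  then show ?thesis by blast
qed

text \<open>The bound \<open>4 * q + 1\<close> is two clusters of at most \<open>2 * q\<close>
  vertices each and the leftover vertex. The intervals are carried to \<open>V\<close> by an
  enumeration.\<close>

lemma ex_balanced_clustering:
  assumes V: "finite V" and n: "odd (card V)" "q < card V" and q: "even q" "q > 0"
  shows "\<exists>K. clustering V K (4 * q + 1) q \<and> (\<forall>\<beta>. clustering.balanced V K \<beta> \<noteq> {})"
proof -
  let ?n = "card V"
  obtain h where h: "bij_betw h V {..<?n}" using ex_bij_betw_finite_nat[OF V] by (auto simp: atLeast0LessThan)
  obtain c :: "nat \<Rightarrow> nat" where c: "\<And>b. {j \<in> {1..<?n}. c j = b} = {} \<or>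
    (\<exists>l u. odd l \<and> odd u \<and> l + q \<le> u \<and> u \<le> l + 2 * q \<and> {j \<in> {1..<?n}. c j = b} = {l..<u})"
    using ex_interval_clusters[OF n q] by blast
  define I where "I b = {j \<in> {1..<?n}. c j = b}" for b
  have I_iff: "j \<in> I b \<longleftrightarrow> 0 < j \<and> j < ?n \<and> c j = b" for j b unfolding I_def by auto
  have cI: "I b = {} \<or> (\<exists>l u. odd l \<and> odd u \<and> l + q \<le> u \<and> u \<le> l + 2 * q \<and> I b = {l..<u})" for b
    using c[of b] unfolding I_def .
  define L :: "nat \<Rightarrow> nat set" where "L j = (if j = 0 then {} else {c j})" for j
  define K where "K w = L (h w)" for w
  have inj: "inj_on h V" and im: "h ` V = {..<?n}" using h by (auto simp: bij_betw_def)
  have hn: "h w < ?n" if "w \<in> V" for w using im that by auto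
  have card_transfer: "card {w \<in> V. P (h w)} = card {j \<in> {..<?n}. P j}" for P
  proof -
    have "h ` {w \<in> V. P (h w)} = {j \<in> {..<?n}. P j}" using im by auto
    then show ?thesis using card_image[of h "{w \<in> V. P (h w)}"] inj_on_subset[OF inj] by (metis (no_types, lifting) mem_Collect_eq subsetI)
  qed
  have cluster: "{j \<in> {..<?n}. L j = {b}} = I b" for b
    by (auto simp: L_def I_iff)
  have cluster_le: "card (I b) \<le> 2 * q" for b
  proof (cases "I b = {}")
    case False
    then obtain l u where "u \<le> l + 2 * q" "I b = {l..<u}" using cI by blast
    then show ?thesis by simp
  qed simp
  have cluster_ge: "q \<le> card (I b)" if ne: "I b \<noteq> {}" for b
  proof -
    obtain l u where "l + q \<le> u" "I b = {l..<u}" using cI[of b] ne by blast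
    then show ?thesis by simp
  qed
  interpret clustering V K "4 * q + 1" q
  proof
    show "finite V" by fact
    show "K w = {} \<or> (\<exists>i. K w = {i})" for w by (simp add: K_def L_def)
    show "card {w \<in> V. K w \<subseteq> \<beta>} \<le> 4 * q + 1" if \<beta>: "finite \<beta>" "card \<beta> \<le> 2" for \<beta>
    proof -
      have "{j \<in> {..<?n}. L j \<subseteq> \<beta>} \<subseteq> insert 0 (\<Union>b\<in>\<beta>. I b)"
        by (auto simp: L_def I_iff split: if_splits)
      then have "card {j \<in> {..<?n}. L j \<subseteq> \<beta>} \<le> card (insert 0 (\<Union>b\<in>\<beta>. I b))"
        using \<beta> by (intro card_mono) (auto simp: I_def)
      also have "\<dots> \<le> Suc (card (\<Union>b\<in>\<beta>. I b))" using \<beta> by (simp add: card_insert_if I_def)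
      also have "card (\<Union>b\<in>\<beta>. I b) \<le> (\<Sum>b\<in>\<beta>. card (I b))"
        by (rule card_UN_le[OF \<beta>(1)])
      also have "\<dots> \<le> card \<beta> * (2 * q)" using sum_bounded_above[of \<beta> _ "2 * q"] cluster_le by simp
      also have "\<dots> \<le> 2 * (2 * q)" using \<beta> by (intro mult_le_mono1)
      finally show ?thesis unfolding K_def card_transfer[of "\<lambda>j. L j \<subseteq> \<beta>"] by simp
    qed
    show "q \<le> card {w' \<in> V. K w' = {i}}" if "w \<in> V" "K w = {i}" for w i
    proof -
      have "h w \<in> {j \<in> {..<?n}. L j = {i}}" using that hn by (simp add: K_def)
      then show ?thesis unfolding K_def card_transfer[of "\<lambda>j. L j = {i}"] unfolding cluster
        by (intro cluster_ge) blast
    qed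
  qed
  have "balanced \<beta> \<noteq> {}" for \<beta>
  proof -
    define d where "d z = (if z \<in> positions \<and> block z = \<beta> then alt_sign (h (fst z)) (h (snd z)) else 0)" for z
    have "d \<in> balanced \<beta>"
    proof (rule balancedI)
      fix z assume z: "z \<in> positions" "block z = \<beta>"
      then have "h (fst z) \<noteq> h (snd z)"
        using inj_on_eq_iff[OF inj, of "fst z" "snd z"] by (simp add: positions_def mem_Times_iff)
      then have "alt_sign (h (fst z)) (h (snd z)) = 1 \<or> alt_sign (h (fst z)) (h (snd z)) = -1"
        unfolding alt_sign_def by (cases "even (h (fst z) + h (snd z))") simp_all
      then show "d z = 1 \<or> d z = -1" using z by (simp add: d_def)
    next
      fix z assume "\<not> (z \<in> positions \<and> block z = \<beta>)"
      then show "d z = 0" unfolding d_def by (rule if_not_P)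
    next
      fix u v
      have "(v, u) \<in> positions \<longleftrightarrow> (u, v) \<in> positions" "block (v, u) = block (u, v)"
        by (auto simp: positions_def block_def)
      moreover have "alt_sign (h v) (h u) = - alt_sign (h u) (h v)"
        by (simp add: alt_sign_def add.commute)
      ultimately show "d (v, u) = - d (u, v)" by (simp add: d_def)
    next
      fix u assume u: "u \<in> V"
      have "(\<Sum>v\<in>V. d (u, v)) = (\<Sum>v\<in>V. if h v \<noteq> h u \<and> L (h u) \<union> L (h v) = \<beta> then alt_sign (h u) (h v) else 0)"
        using u inj_on_eq_iff[OF inj u] alt_sign_def[of "h u" "h u"]
        by (intro sum.cong refl) (auto simp: d_def positions_def block_def K_def)
      also have "\<dots> = (\<Sum>j\<in>{..<?n}. if j \<noteq> h u \<and> L (h u) \<union> L j = \<beta> then alt_sign (h u) j else 0)"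
        by (rule sum.reindex_bij_betw[OF h])
      also have "\<dots> = (\<Sum>j | j < ?n \<and> j \<noteq> h u \<and> L (h u) \<union> L j = \<beta>. alt_sign (h u) j)"
        by (rule sum.mono_neutral_cong_right) auto
      also have "\<dots> = 0"
      proof (rule sum_alt_sign_block[OF _ L_def hn[OF u]])
        fix b
        show "{j \<in> {1..<?n}. c j = b} = {} \<or>
          (\<exists>l u. odd l \<and> odd u \<and> l \<le> u \<and> {j \<in> {1..<?n}. c j = b} = {l..<u})"
          using cI[of b] add_leD1 unfolding I_def[symmetric] by blast
      qed
      finally show "(\<Sum>v\<in>V. d (u, v)) = 0" .
    qed
    then show ?thesis by blast
  qed
  then show ?thesis using clustering_axioms by blast
qed

section \<open>Tournaments and copies\<close>

lemma regular_tournament_of_sign: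
  fixes V :: "'a set"
  assumes V: "finite V" "odd (card V)" and x: "regular_sign V x"
  defines "G \<equiv> \<lparr>pverts = V, parcs = {z \<in> V \<times> V. x z = 1}\<rparr>"
  shows "regular_tournament G"
proof -
  define U :: "'a pair_pre_digraph" where "U = \<lparr>pverts = V, parcs = {(u, v) \<in> V \<times> V. u \<noteq> v}\<rparr>"
  have sw: "x (v, u) = 1 \<longleftrightarrow> x (u, v) = -1" for u v using regular_signD(2)[OF x, of v u] by auto
  have pm: "x (u, v) = 1 \<or> x (u, v) = -1" if "u \<in> V" "v \<in> V" "u \<noteq> v" for u v
    using regular_signD(1)[OF x that] .
  have "finite {(u, v) \<in> V \<times> V. u \<noteq> v}"
    by (rule finite_subset[of _ "V \<times> V"]) (use V in auto)
  then have U: "pair_graph U"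
    using V by unfold_locales (auto simp: U_def symmetric_def sym_def)
  have arcsG: "(u, v) \<in> parcs G \<longleftrightarrow> u \<in> V \<and> v \<in> V \<and> x (u, v) = 1" for u v
    by (simp add: G_def)
  have "orients G U"
    unfolding orients_def
  proof (intro conjI allI impI U)
    show "pverts G = pverts U" by (simp add: G_def U_def)
    show "parcs G \<subseteq> parcs U" using regular_signD(3)[OF x] by (auto simp: G_def U_def)
    fix u v assume "(u, v) \<in> parcs U"
    then have uv: "u \<in> V" "v \<in> V" "u \<noteq> v" by (auto simp: U_def)
    show "(u, v) \<in> parcs G \<longleftrightarrow> (v, u) \<notin> parcs G"
      using pm[OF uv] by (auto simp: arcsG uv sw[of v u])
  qed
  moreover have "complete_digraph (card (pverts U)) (with_proj U)"
    unfolding complete_digraph_pair_def using V by (auto simp: U_def)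
  ultimately have "tournament G" unfolding tournament_def by blast
  moreover have "in_degree (with_proj G) v = (card V - 1) div 2 \<and> out_degree (with_proj G) v = (card V - 1) div 2"
    if v: "v \<in> V" for v
  proof -
    define S T where "S = {u \<in> V. x (v, u) = 1}" and "T = {u \<in> V. x (v, u) = -1}"
    have fin: "finite S" "finite T" using V by (auto simp: S_def T_def)
    have split: "V = insert v (S \<union> T)" using pm[OF v] v by (auto simp: S_def T_def)
    have disj: "v \<notin> S \<union> T" "S \<inter> T = {}" using regular_signD(3)[OF x] by (auto simp: S_def T_def)
    have "0 = (\<Sum>u\<in>V. x (v, u))" using regular_signD(4)[OF x v] by simp
    also have "\<dots> = x (v, v) + (\<Sum>u\<in>S \<union> T. x (v, u))"
      using fin disj by (subst split) (simp del: Un_iff)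
    also have "(\<Sum>u\<in>S \<union> T. x (v, u)) = (\<Sum>u\<in>S. x (v, u)) + (\<Sum>u\<in>T. x (v, u))"
      using fin disj by (intro sum.union_disjoint)
    also have "\<dots> = real (card S) - real (card T)"
      by (simp add: S_def T_def)
    finally have OI: "card S = card T" using regular_signD(3)[OF x] by simp
    have "card V = Suc (card (S \<union> T))" using fin disj by (subst split) (simp del: Un_iff)
    also have "card (S \<union> T) = card S + card T" using fin disj by (intro card_Un_disjoint)
    finally have cV: "card V = Suc (card S + card T)" .
    have "out_arcs (with_proj G) v = Pair v ` S" using v by (auto simp: out_arcs_def arcsG S_def G_def)
    then have "out_degree (with_proj G) v = card S" by (simp add: out_degree_def card_image inj_on_def)
    moreover have "in_arcs (with_proj G) v = (\<lambda>u. (u, v)) ` T"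
      using v by (auto simp: in_arcs_def T_def G_def sw[where u = v])
    then have "in_degree (with_proj G) v = card T" by (simp add: in_degree_def card_image inj_on_def)
    ultimately show ?thesis using OI cV by simp
  qed
  ultimately show ?thesis using V unfolding regular_tournament_def by (simp add: G_def)
qed

text \<open>A permutation contributes \<open>2 ^ card (parcs H)\<close> if it sends every arc to an
  arc, and \<open>0\<close> otherwise. Restricting to the vertex set embeds the former into the
  extensional bijections counted by \<open>labeled_copies\<close>.\<close>

lemma sum_prod_sign_le_copies:
  assumes V: "finite (pverts H)" and E: "parcs H \<subseteq> pverts H \<times> pverts H" "\<And>e. e \<in> parcs H \<Longrightarrow> fst e \<noteq> snd e"
    and x: "regular_sign (pverts H) x"
  shows "(\<Sum>p | p permutes pverts H. \<Prod>e\<in>parcs H. 1 + x (map_prod p p e))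
    \<le> 2 ^ card (parcs H) *
      real (labeled_copies \<lparr>pverts = pverts H, parcs = {z \<in> pverts H \<times> pverts H. x z = 1}\<rparr> H)"
proof -
  let ?V = "pverts H" and ?E = "parcs H"
  let ?G = "\<lparr>pverts = ?V, parcs = {z \<in> ?V \<times> ?V. x z = 1}\<rparr>"
  let ?P = "{p. p permutes ?V \<and> (\<forall>e\<in>?E. x (map_prod p p e) = 1)}"
  let ?C = "{\<phi> \<in> ?V \<rightarrow>\<^sub>E ?V. bij_betw \<phi> ?V ?V \<and> (\<forall>u v. (u, v) \<in> ?E \<longrightarrow> (\<phi> u, \<phi> v) \<in> parcs ?G)}"
  have finE: "finite ?E" using E(1) V finite_subset by blast
  have val: "(\<Prod>e\<in>?E. 1 + x (map_prod p p e)) = 2 ^ card ?E * of_bool (p \<in> ?P)" if p: "p permutes ?V" for p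
  proof (cases "\<forall>e\<in>?E. x (map_prod p p e) = 1")
    case True
    then show ?thesis using p by simp
  next
    case False
    then obtain e where e: "e \<in> ?E" "x (map_prod p p e) \<noteq> 1" by blast
    have "p (fst e) \<noteq> p (snd e)" using E(2)[OF e(1)] permutes_inj[OF p] by (simp add: inj_eq)
    moreover have "p (fst e) \<in> ?V" "p (snd e) \<in> ?V" using e E(1) permutes_in_image[OF p] by auto
    ultimately have "x (p (fst e), p (snd e)) = 1 \<or> x (p (fst e), p (snd e)) = -1"
      by (intro regular_signD(1)[OF x])
    then have "1 + x (map_prod p p e) = 0" using e(2) by (auto simp: map_prod_def split_beta)
    then have "(\<Prod>e\<in>?E. 1 + x (map_prod p p e)) = 0" using e(1) finE by (auto intro!: prod_zero)
    then show ?thesis using False by simp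
  qed
  have finP: "finite {p. p permutes ?V}" using V by (rule finite_permutations)
  have "(\<Sum>p | p permutes ?V. \<Prod>e\<in>?E. 1 + x (map_prod p p e)) = (\<Sum>p | p permutes ?V. 2 ^ card ?E * of_bool (p \<in> ?P))"
    using val by (intro sum.cong) auto
  also have "\<dots> = 2 ^ card ?E * real (card {p \<in> {p. p permutes ?V}. p \<in> ?P})"
    by (simp only: sum_distrib_left card_eq_sum_of_bool[OF finP])
  also have "{p \<in> {p. p permutes ?V}. p \<in> ?P} = ?P" by auto
  also have "card ?P \<le> card ?C"
  proof (rule card_inj_on_le[of "\<lambda>p. restrict p ?V"])
    show "inj_on (\<lambda>p. restrict p ?V) ?P"
    proof (rule inj_onI)
      fix p p' assume "p \<in> ?P" "p' \<in> ?P" and eq: "restrict p ?V = restrict p' ?V"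
      then have pp: "p permutes ?V" "p' permutes ?V" by auto
      show "p = p'"
      proof
        fix v show "p v = p' v"
          using fun_cong[OF eq, of v] permutes_not_in[OF pp(1), of v] permutes_not_in[OF pp(2), of v]
          by (cases "v \<in> ?V") auto
      qed
    qed
    show "(\<lambda>p. restrict p ?V) ` ?P \<subseteq> ?C"
    proof (rule image_subsetI)
      fix p assume p': "p \<in> ?P"
      then have p: "p permutes ?V" by simp
      have "bij_betw (restrict p ?V) ?V ?V"
        using bij_betw_cong[of ?V p "restrict p ?V" ?V] permutes_imp_bij[OF p] by simp
      moreover have "restrict p ?V \<in> ?V \<rightarrow>\<^sub>E ?V" using permutes_in_image[OF p] by auto
      moreover have "(restrict p ?V u, restrict p ?V v) \<in> parcs ?G" if uv: "(u, v) \<in> ?E" for u v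
      proof -
        have "u \<in> ?V" "v \<in> ?V" using uv E(1) by auto
        moreover have "x (p u, p v) = 1" using p' uv by force
        ultimately show ?thesis using permutes_in_image[OF p] by simp
      qed
      ultimately show "restrict p ?V \<in> ?C" by blast
    qed
    show "finite ?C" by (rule finite_subset[of _ "?V \<rightarrow>\<^sub>E ?V"]) (use V in \<open>auto intro: finite_PiE\<close>)
  qed
  finally show ?thesis unfolding labeled_copies_def by simp
qed

lemma orientation_arcs:
  fixes H :: "'a pair_pre_digraph"
  assumes "orientation H"
  shows "finite (pverts H)" "parcs H \<subseteq> pverts H \<times> pverts H"
    and "(u, v) \<in> parcs H \<Longrightarrow> (v, u) \<notin> parcs H"
    and "max_degree H \<le> k \<Longrightarrow> v \<in> pverts H \<Longrightarrow> card {e \<in> parcs H. v \<in> ends e} \<le> k"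
proof -
  obtain U where U: "orients H U" using assms unfolding orientation_def by blast
  interpret U: pair_graph U using U by (simp add: orients_def)
  have V: "pverts H = pverts U" and sub: "parcs H \<subseteq> parcs U"
    and iff: "\<And>u v. (u, v) \<in> parcs U \<Longrightarrow> (u, v) \<in> parcs H \<longleftrightarrow> (v, u) \<notin> parcs H"
    using U unfolding orients_def by auto
  show fin: "finite (pverts H)" unfolding V by (rule U.pair_finite_verts)
  show "parcs H \<subseteq> pverts H \<times> pverts H"
    unfolding V using sub U.arc_fst_in_verts U.arc_snd_in_verts by fastforce
  show asym: "(v, u) \<notin> parcs H" if "(u, v) \<in> parcs H" for u v
    using that sub iff[of u v] by blast
  have sym: "(v, u) \<in> parcs U" if "(u, v) \<in> parcs U" for u v
    using U.sym_arcs that by (auto simp: symmetric_def dest: symD)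
  show "card {e \<in> parcs H. v \<in> ends e} \<le> k" if k: "max_degree H \<le> k" and v: "v \<in> pverts H" for v
  proof -
    \<comment> \<open>Every arc at \<open>v\<close> is turned so that it leaves \<open>v\<close> in
      the symmetric graph. Two distinct arcs with the same image would be reverses of each
      other.\<close>
    let ?f = "\<lambda>e. if fst e = v then e else prod.swap e"
    have "card {e \<in> parcs H. v \<in> ends e} \<le> card (out_arcs (with_proj U) v)"
    proof (rule card_inj_on_le[of ?f])
      show "inj_on ?f {e \<in> parcs H. v \<in> ends e}"
      proof (rule inj_onI)
        fix e e' assume e: "e \<in> {e \<in> parcs H. v \<in> ends e}" "e' \<in> {e \<in> parcs H. v \<in> ends e}" and eq: "?f e = ?f e'"
        show "e = e'"
        proof (rule ccontr)
          assume "e \<noteq> e'"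
          then have "e' = prod.swap e" using eq
            by (cases "fst e = v"; cases "fst e' = v") (auto simp: prod_eq_iff)
          then show False using e asym[of "fst e" "snd e"] by (auto simp: prod.swap_def)
        qed
      qed
      show "?f ` {e \<in> parcs H. v \<in> ends e} \<subseteq> out_arcs (with_proj U) v"
        using sub sym by (auto simp: out_arcs_def ends_def)
      show "finite (out_arcs (with_proj U) v)"
        using U.pair_finite_arcs by (auto simp: out_arcs_def)
    qed
    also have "\<dots> = out_degree (with_proj (underlying_graph H)) v"
      using orients_underlying_graph[OF U] by (simp add: out_degree_def)
    also have "\<dots> \<le> max_degree H"
      unfolding max_degree_def using fin v by (intro Max_ge) auto
    finally show ?thesis using k by linarith
  qed
qed

lemma real_choose_two: "real (m choose 2) = (real m * real m - real m) / 2"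
proof -
  have "real (m choose 2) = real (m * (m - 1)) / 2"
    unfolding choose_two by (subst real_of_nat_div) auto
  then show ?thesis by (cases m) (auto simp: algebra_simps)
qed

text \<open>All ordered pairs are grouped by the common vertex and the diagonal is removed. The four
  choices of \<open>fst\<close> and \<open>snd\<close> for \<open>f\<close> and \<open>g\<close>
  give the four terms of \<open>surplus\<close>.\<close>

lemma sum_coincident_pairs:
  assumes E: "finite E" and V: "finite V" and f: "\<And>e. e \<in> E \<Longrightarrow> f e \<in> V"
  shows "(\<Sum>(e, e')\<in>{(e, e') \<in> E \<times> E. e \<noteq> e'}. of_bool (f e = g e') :: real)
    = (\<Sum>v\<in>V. real (card {e \<in> E. f e = v}) * real (card {e \<in> E. g e = v})) - (\<Sum>e\<in>E. of_bool (f e = g e))"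
proof -
  have "(\<Sum>(e, e')\<in>E \<times> E. of_bool (f e = g e') :: real)
    = (\<Sum>(e, e')\<in>{(e, e') \<in> E \<times> E. e \<noteq> e'}. of_bool (f e = g e')) + (\<Sum>(e, e')\<in>(\<lambda>e. (e, e)) ` E. of_bool (f e = g e'))"
  proof -
    have eq: "E \<times> E = {(e, e') \<in> E \<times> E. e \<noteq> e'} \<union> (\<lambda>e. (e, e)) ` E" by auto
    have fin: "finite {(e, e') \<in> E \<times> E. e \<noteq> e'}"
      by (rule finite_subset[of _ "E \<times> E"]) (use E in auto)
    have "(\<Sum>(e, e')\<in>{(e, e') \<in> E \<times> E. e \<noteq> e'} \<union> (\<lambda>e. (e, e)) ` E. of_bool (f e = g e') :: real)
      = (\<Sum>(e, e')\<in>{(e, e') \<in> E \<times> E. e \<noteq> e'}. of_bool (f e = g e')) + (\<Sum>(e, e')\<in>(\<lambda>e. (e, e)) ` E. of_bool (f e = g e'))"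
      using fin E by (intro sum.union_disjoint) auto
    then show ?thesis by (simp only: eq[symmetric])
  qed
  moreover have "(\<Sum>(e, e')\<in>(\<lambda>e. (e, e)) ` E. of_bool (f e = g e') :: real) = (\<Sum>e\<in>E. of_bool (f e = g e))"
    by (subst sum.reindex) (auto simp: inj_on_def)
  moreover have "(\<Sum>(e, e')\<in>E \<times> E. of_bool (f e = g e') :: real)
    = (\<Sum>v\<in>V. real (card {e \<in> E. f e = v}) * real (card {e \<in> E. g e = v}))"
  proof -
    have "(\<Sum>(e, e')\<in>E \<times> E. of_bool (f e = g e') :: real) = (\<Sum>e\<in>E. real (card {e' \<in> E. g e' = f e}))"
      by (simp only: card_eq_sum_of_bool[OF E] sum.cartesian_product[symmetric] eq_commute[of "f _"])
    also have "\<dots> = (\<Sum>v\<in>V. \<Sum>e\<in>{e \<in> E. f e = v}. real (card {e' \<in> E. g e' = f e}))"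
      using E V f by (intro sum.group[symmetric]) auto
    also have "\<dots> = (\<Sum>v\<in>V. real (card {e \<in> E. f e = v}) * real (card {e \<in> E. g e = v}))"
      by (intro sum.cong refl) simp
    finally show ?thesis .
  qed
  ultimately show ?thesis by linarith
qed

lemma (in balanced_clustering) surplus_eq:
  assumes H: "pverts H = V" "parcs H = E"
  shows "surplus = real (plus_sum H) - real (minus_sum H)"
proof -
  let ?o = "\<lambda>v. real (card {e \<in> E. fst e = v})" and ?i = "\<lambda>v. real (card {e \<in> E. snd e = v})"
  let ?P = "{(e, e') \<in> E \<times> E. e \<noteq> e'}"
  have deg: "out_degree (with_proj H) v = card {e \<in> E. fst e = v}" "in_degree (with_proj H) v = card {e \<in> E. snd e = v}" for v
    by (simp_all add: out_degree_def in_degree_def out_arcs_def in_arcs_def H)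
  have V: "fst e \<in> V" "snd e \<in> V" if "e \<in> E" for e using that E_subset by auto
  \<comment> \<open>The diagonal drops out of the two mixed terms. In the other two it contributes
    \<open>card E\<close>, which as a degree sum turns the squares into binomial
    coefficients.\<close>
  have loop: "(\<Sum>e\<in>E. of_bool (snd e = fst e)) = (0 :: real)" "(\<Sum>e\<in>E. of_bool (fst e = snd e)) = (0 :: real)"
    using arc_neq by (auto intro!: sum.neutral dest!: arc_neq simp: eq_commute[of "snd _"])
  have "real (card E) = (\<Sum>v\<in>V. ?o v)" "real (card E) = (\<Sum>v\<in>V. ?i v)"
    using sum.group[OF finite_E finite_V, of fst "\<lambda>_. 1 :: real"] sum.group[OF finite_E finite_V, of snd "\<lambda>_. 1 :: real"] V
    by (auto simp: image_subset_iff)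
  note cardE = this
  have "2 * surplus = (\<Sum>(e, e')\<in>?P. of_bool (snd e = fst e')) + (\<Sum>(e, e')\<in>?P. of_bool (fst e = snd e'))
     - (\<Sum>(e, e')\<in>?P. of_bool (fst e = fst e')) - (\<Sum>(e, e')\<in>?P. of_bool (snd e = snd e'))"
    unfolding surplus_def by (simp add: split_beta sum.distrib sum_subtractf)
  also have "\<dots> = (\<Sum>v\<in>V. ?i v * ?o v) + (\<Sum>v\<in>V. ?o v * ?i v) - ((\<Sum>v\<in>V. ?o v * ?o v) - (\<Sum>v\<in>V. ?o v))
     - ((\<Sum>v\<in>V. ?i v * ?i v) - (\<Sum>v\<in>V. ?i v))"
    using sum_coincident_pairs[OF finite_E finite_V V(2), where g = fst] sum_coincident_pairs[OF finite_E finite_V V(1), where g = snd]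
      sum_coincident_pairs[OF finite_E finite_V V(1), where g = fst] sum_coincident_pairs[OF finite_E finite_V V(2), where g = snd]
      loop cardE by simp
  also have "\<dots> = 2 * ((\<Sum>v\<in>V. ?o v * ?i v) - (\<Sum>v\<in>V. (?o v * ?o v - ?o v) / 2 + (?i v * ?i v - ?i v) / 2))"
  proof -
    have halves: "(\<Sum>v\<in>V. (?o v * ?o v - ?o v) / 2 + (?i v * ?i v - ?i v) / 2)
      = ((\<Sum>v\<in>V. ?o v * ?o v) - (\<Sum>v\<in>V. ?o v)) / 2 + ((\<Sum>v\<in>V. ?i v * ?i v) - (\<Sum>v\<in>V. ?i v)) / 2"
      by (simp add: sum.distrib sum_subtractf sum_divide_distrib[symmetric])
    have comm: "(\<Sum>v\<in>V. ?i v * ?o v) = (\<Sum>v\<in>V. ?o v * ?i v)"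
      by (intro sum.cong refl mult.commute)
    have "b + b - (a - c) - (d - e) = 2 * (b - ((a - c) / 2 + (d - e) / 2))" for a b c d e :: real
      by (simp add: field_simps)
    then show ?thesis unfolding halves comm .
  qed
  also have "(\<Sum>v\<in>V. ?o v * ?i v) = real (plus_sum H)" by (simp add: plus_sum_def deg H)
  also have "(\<Sum>v\<in>V. (?o v * ?o v - ?o v) / 2 + (?i v * ?i v - ?i v) / 2) = real (minus_sum H)"
    by (simp add: minus_sum_def deg H real_choose_two)
  finally show ?thesis by simp
qed

theorem theorem1p1:
  fixes \<epsilon> :: real and k :: nat
  assumes "\<epsilon> > 0" and "k > 0"
  shows "\<exists>(N :: nat) (\<delta> :: real). \<delta> > 0 \<and>
           (\<forall>n > N. odd n \<longrightarrow>
             (\<forall>H :: 'a pair_pre_digraph.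
               card (pverts H) = n \<and> consistent_orientation \<epsilon> k H \<longrightarrow>
               real (max_regular_copies H) \<ge> (1 + \<delta>) * fact n / 2 ^ card (parcs H)))"
proof -
  \<comment> \<open>\<open>1152 = 4 * 288\<close>, so that the quadratic loss is at most
    \<open>\<epsilon>/4\<close>.\<close>
  obtain m :: nat where m: "1152 * k\<^sup>2 / \<epsilon> \<le> real m" using real_arch_simple by blast
  \<comment> \<open>Even, as the interval clusters demand, and at least \<open>4\<close>, which
    gives both \<open>q \<ge> 3\<close> and \<open>B \<le> 8 * (q - 1)\<close>.\<close>
  define q where "q = 2 * (m + 2)"
  define B where "B = 4 * q + 1"
  define C\<^sub>0 :: real where "C\<^sub>0 = 16 * k * B + 4 * k * B\<^sup>2"
  define D :: real where "D = (1 + 36 * k\<^sup>2 + 2 * k * C\<^sub>0) * (4 * k * B * C\<^sub>0 + k * C\<^sub>0\<^sup>2)"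
  \<comment> \<open>\<open>D / n\<close> is the cost of the bad \<open>p\<close>, at most
    \<open>\<epsilon>/4\<close> from here on. The gain of \<open>\<epsilon>\<close> thus loses two
    quarters, leaving \<open>\<epsilon>/2\<close> as the witness for
    \<open>\<delta>\<close>.\<close>
  obtain N\<^sub>0 :: nat where N\<^sub>0: "4 * D / \<epsilon> \<le> real N\<^sub>0" using real_arch_simple by blast
  define N where "N = max 20 (max q N\<^sub>0)"
  have "1152 * k\<^sup>2 / \<epsilon> \<le> real q - 1" using m by (simp add: q_def)
  moreover have q1: "real q - 1 > 0" by (simp add: q_def)
  ultimately have q_loss: "288 * k\<^sup>2 / (real q - 1) \<le> \<epsilon> / 4" using assms(1) by (simp add: field_simps)
  have main: "(1 + \<epsilon> / 2) * fact n / 2 ^ card (parcs H) \<le> real (max_regular_copies H)"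
    if n: "n > N" "odd n" and H: "card (pverts H) = n" "consistent_orientation \<epsilon> k H"
    for n and H :: "'a pair_pre_digraph"
  proof -
    have or: "orientation H" and deg: "max_degree H \<le> k"
      and pm: "\<epsilon> * n \<le> real (plus_sum H) - real (minus_sum H)"
      using H unfolding consistent_orientation_def by auto
    note arcs = orientation_arcs[OF or]
    have n_large: "n \<ge> 20" "q < n" "real N\<^sub>0 \<le> n" using n by (auto simp: N_def)
    obtain K where K: "clustering (pverts H) K B q" "\<And>\<beta>. clustering.balanced (pverts H) K \<beta> \<noteq> {}"
      using ex_balanced_clustering[OF arcs(1), of q] n n_large H(1) unfolding B_def by (auto simp: q_def)
    interpret balanced_clustering "pverts H" K B q "parcs H" k
    proof -
      interpret clustering "pverts H" K B q by (rule K(1))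
      show "balanced_clustering (pverts H) K B q (parcs H) k"
        by unfold_locales (use arcs deg H(1) n_large K(2) in \<open>auto simp: q_def\<close>)
    qed
    have "4 * D / \<epsilon> \<le> real n" using N\<^sub>0 n_large by linarith
    then have Dn: "D / n \<le> \<epsilon> / 4"
      using n_large assms(1) by (simp add: field_simps)
    have B_le: "real B \<le> 8 * (real q - 1)" by (simp add: B_def q_def)
    have C_eq: "C = C\<^sub>0" by (simp add: C_def C\<^sub>0_def)
    have "\<epsilon> \<le> \<epsilon> * n / (real n - 2)" using assms(1) n_large by (simp add: field_simps)
    also have "\<dots> \<le> surplus / (real n - 2)"
      using pm surplus_eq[of H] n_large by (intro divide_right_mono) auto
    finally have "1 + \<epsilon> / 2 \<le> 1 + surplus / (real n - 2) - 288 * k\<^sup>2 / (real q - 1) - D / n"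
      using q_loss Dn by linarith
    then have "fact n * (1 + \<epsilon> / 2) \<le> fact n * (1 + surplus / (real n - 2) - 288 * k\<^sup>2 / (real q - 1) - D / n)"
      by (intro mult_left_mono) auto
    also have "\<dots> \<le> (\<Sum>p | p permutes pverts H. global_avg p)"
      using sum_global_avg_ge[OF B_le] unfolding H(1) C_eq D_def .
    finally obtain x where x: "regular_sign (pverts H) x"
      "fact n * (1 + \<epsilon> / 2) \<le> (\<Sum>p | p permutes pverts H. \<Prod>e\<in>parcs H. 1 + x (map_prod p p e))"
      using ex_orientation_ge by blast
    define G where "G = \<lparr>pverts = pverts H, parcs = {z \<in> pverts H \<times> pverts H. x z = 1}\<rparr>"
    have "regular_tournament G"
      unfolding G_def using arcs(1) n H(1) x(1) by (intro regular_tournament_of_sign) auto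
    then have "labeled_copies G H \<le> max_regular_copies H"
      unfolding max_regular_copies_def using finite_regular_copies[OF arcs(1)]
      by (intro Max_ge) (auto simp: G_def)
    then have "2 ^ card (parcs H) * real (labeled_copies G H) \<le> 2 ^ card (parcs H) * real (max_regular_copies H)"
      by (intro mult_left_mono) auto
    moreover have "(\<Sum>p | p permutes pverts H. \<Prod>e\<in>parcs H. 1 + x (map_prod p p e))
      \<le> 2 ^ card (parcs H) * real (labeled_copies G H)"
      unfolding G_def using arcs(1,2) arc_neq x(1) by (intro sum_prod_sign_le_copies)
    ultimately have "fact n * (1 + \<epsilon> / 2) \<le> 2 ^ card (parcs H) * real (max_regular_copies H)"
      using x(2) by linarith
    then show ?thesis by (simp add: pos_divide_le_eq mult.commute)
  qed
  show ?thesis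
    by (rule exI[of _ N], rule exI[of _ "\<epsilon> / 2"]) (use main assms(1) in auto)
qed

end
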